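(* Let $d\ge 3$ and let $\mathbb{X}\subseteq V_{1,d}\subseteq\mathbb{P}^d$ be a reduced complete intersection. Then either $\mathbb{X}$ is a point or $\mathbb{X}$ is a set of two points.
   Context: $\mathbb{K}$ is an algebraically closed field of characteristic $0$, and projective spaces are over $\mathbb{K}$. $V_{1,d}\subseteq\mathbb{P}^d$ is the rational normal curve, i.e. the image of $\nu_{1,d}:\mathbb{P}^1\to\mathbb{P}^d$, $[x_0,x_1]\mapsto[x_0^d,x_0^{d-1}x_1,\dots,x_1^d]$. Varieties are non-empty reduced closed subschemes (not necessarily irreducible), and $\mathcal{I}(\mathbb{X})$ is the homogeneous (radical) ideal of $\mathbb{X}$ in the coordinate ring of $\mathbb{P}^d$. $\mathbb{X}$ is a complete intersection if $\mathcal{I}(\mathbb{X})$ can be generated by $r$ homogeneous polynomials of positive degree, where $r=\operatorname{codim}\mathbb{X}$ in $\mathbb{P}^d$. *)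

theory Defs
  imports
    "HOL-Computational_Algebra.Polynomial"
    "HOL-Library.Extended_Nat"
    "Jordan_Normal_Form.Matrix"
    "HOL-Library.Poly_Mapping"
begin

text \<open>
  Projective space of dimension \<open>d\<close>: classes of nonzero vectors with coordinates
  \<open>0, \<dots>, d\<close> modulo nonzero scalars. A point is the set of all its representatives.
\<close>

definition proj_reps :: "nat \<Rightarrow> 'k::field vec set" where
  "proj_reps d = carrier_vec (Suc d) - {0\<^sub>v (Suc d)}"

definition proj_rel :: "nat \<Rightarrow> ('k::field vec \<times> 'k vec) set" where
  "proj_rel d = {(v, w). v \<in> proj_reps d \<and> w \<in> proj_reps d \<and> (\<exists>c. c \<noteq> 0 \<and> w = c \<cdot>\<^sub>v v)}"

lemma equiv_proj_rel: "equiv (proj_reps d) (proj_rel d :: ('k::field vec \<times> 'k vec) set)"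
proof (rule equivI)
  show "refl_on (proj_reps d) (proj_rel d :: ('k vec \<times> 'k vec) set)"
    by (auto simp: refl_on_def proj_rel_def intro!: exI[of _ 1])
  show "proj_rel d \<subseteq> proj_reps d \<times> (proj_reps d :: 'k vec set)"
    by (auto simp: proj_rel_def)
  show "sym (proj_rel d :: ('k vec \<times> 'k vec) set)"
  proof (rule symI)
    fix v w :: "'k vec" assume "(v, w) \<in> proj_rel d"
    then obtain c where "v \<in> proj_reps d" "w \<in> proj_reps d" "c \<noteq> 0" "w = c \<cdot>\<^sub>v v"
      by (auto simp: proj_rel_def)
    then show "(w, v) \<in> proj_rel d"
      by (auto simp: proj_rel_def smult_smult_assoc intro!: exI[of _ "inverse c"])
  qed
  show "trans (proj_rel d :: ('k vec \<times> 'k vec) set)"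
  proof (rule transI)
    fix u v w :: "'k vec" assume "(u, v) \<in> proj_rel d" "(v, w) \<in> proj_rel d"
    then obtain a b where "u \<in> proj_reps d" "w \<in> proj_reps d" "a \<noteq> 0" "b \<noteq> 0"
      "v = a \<cdot>\<^sub>v u" "w = b \<cdot>\<^sub>v v"
      by (auto simp: proj_rel_def)
    then show "(u, w) \<in> proj_rel d"
      by (auto simp: proj_rel_def smult_smult_assoc intro!: exI[of _ "b * a"])
  qed
qed

definition proj_space :: "nat \<Rightarrow> 'k::field vec set set" where
  "proj_space d = proj_reps d // proj_rel d"

text \<open>
  Multivariate polynomials map monomials to coefficients; the monomial \<open>m\<close> is the product of
  the powers \<open>x\<^sub>i ^ lookup m i\<close>. The coordinate ring of projective \<open>d\<close>-space consists of the
  polynomials in the variables \<open>0, \<dots>, d\<close>.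
\<close>

type_synonym 'k mpoly = "(nat \<Rightarrow>\<^sub>0 nat) \<Rightarrow>\<^sub>0 'k"

definition coord_ring :: "nat \<Rightarrow> 'k::field mpoly set" where
  "coord_ring d = {p. \<forall>m\<in>Poly_Mapping.keys p. Poly_Mapping.keys m \<subseteq> {..d}}"

definition mpoly_eval :: "'k::field vec \<Rightarrow> 'k mpoly \<Rightarrow> 'k" where
  "mpoly_eval v p = (\<Sum>m\<in>Poly_Mapping.keys p.
     Poly_Mapping.lookup p m * (\<Prod>i\<in>Poly_Mapping.keys m. v $ i ^ Poly_Mapping.lookup m i))"

text \<open>As usual, the zero polynomial is homogeneous of every degree.\<close>

definition homogeneous :: "nat \<Rightarrow> 'k::field mpoly \<Rightarrow> bool" where
  "homogeneous e p \<longleftrightarrow> (\<forall>m\<in>Poly_Mapping.keys p. (\<Sum>i\<in>Poly_Mapping.keys m. Poly_Mapping.lookup m i) = e)"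

definition vanishes_at :: "'k::field mpoly \<Rightarrow> 'k vec set \<Rightarrow> bool" where
  "vanishes_at p P \<longleftrightarrow> (\<forall>v\<in>P. mpoly_eval v p = 0)"

definition zero_locus :: "nat \<Rightarrow> 'k::field mpoly set \<Rightarrow> 'k vec set set" where
  "zero_locus d T = {P \<in> proj_space d. \<forall>p\<in>T. vanishes_at p P}"

definition zariski_closed :: "nat \<Rightarrow> 'k::field vec set set \<Rightarrow> bool" where
  "zariski_closed d X \<longleftrightarrow>
     (\<exists>T \<subseteq> coord_ring d. (\<forall>p\<in>T. \<exists>e. homogeneous e p) \<and> X = zero_locus d T)"

text \<open>
  Over an algebraically closed field a reduced closed subscheme is determined by its set of
  closed points, so varieties are represented by such sets. They need not be irreducible.
\<close>

definition projective_variety :: "nat \<Rightarrow> 'k::field vec set set \<Rightarrow> bool" where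
  "projective_variety d X \<longleftrightarrow> zariski_closed d X \<and> X \<noteq> {}"

text \<open>
  Vanishing at all representatives of a point amounts, over an infinite field, to the vanishing
  of all homogeneous components there, so the following is the homogeneous ideal of \<open>X\<close>.
\<close>

definition vanishing_ideal :: "nat \<Rightarrow> 'k::field vec set set \<Rightarrow> 'k mpoly set" where
  "vanishing_ideal d X = {p \<in> coord_ring d. \<forall>P\<in>X. vanishes_at p P}"

definition ideal_generated :: "nat \<Rightarrow> nat \<Rightarrow> (nat \<Rightarrow> 'k::field mpoly) \<Rightarrow> 'k mpoly set" where
  "ideal_generated d r F = {(\<Sum>i<r. a i * F i) | a. \<forall>i<r. a i \<in> coord_ring d}"

definition irreducible_closed :: "nat \<Rightarrow> 'k::field vec set set \<Rightarrow> bool" where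
  "irreducible_closed d Y \<longleftrightarrow> zariski_closed d Y \<and> Y \<noteq> {} \<and>
     (\<forall>A B. zariski_closed d A \<and> zariski_closed d B \<and> Y = A \<union> B \<longrightarrow> Y = A \<or> Y = B)"

text \<open>
  Krull dimension of the topological space \<open>X\<close>: the supremum of the lengths \<open>n\<close> of chains
  \<open>Y 0 \<subset> \<dots> \<subset> Y n\<close> of irreducible closed subsets (meant for nonempty closed \<open>X\<close>).
\<close>

definition variety_dim :: "nat \<Rightarrow> 'k::field vec set set \<Rightarrow> enat" where
  "variety_dim d X = Sup {enat n | n. \<exists>Y. (\<forall>i\<le>n. irreducible_closed d (Y i) \<and> Y i \<subseteq> X) \<and>
     (\<forall>i<n. Y i \<subset> Y (Suc i))}"

definition variety_codim :: "nat \<Rightarrow> 'k::field vec set set \<Rightarrow> enat" where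
  "variety_codim d X = enat d - variety_dim d X"

definition complete_intersection :: "nat \<Rightarrow> 'k::field vec set set \<Rightarrow> bool" where
  "complete_intersection d X \<longleftrightarrow> projective_variety d X \<and>
     (\<exists>r F. enat r = variety_codim d X \<and>
        (\<forall>i<r. F i \<in> coord_ring d \<and> (\<exists>e>0. homogeneous e (F i))) \<and>
        vanishing_ideal d X = ideal_generated d r F)"

definition veronese_vec :: "nat \<Rightarrow> 'k::field vec \<Rightarrow> 'k vec" where
  "veronese_vec d x = vec (Suc d) (\<lambda>i. (x $ 0) ^ (d - i) * (x $ 1) ^ i)"

text \<open>
  The image of the Veronese map from the projective line: the points whose representatives
  include \<open>veronese_vec d x\<close>, for \<open>x\<close> representing a point of the line.
\<close>

definition rational_normal_curve :: "nat \<Rightarrow> 'k::field vec set set" where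
  "rational_normal_curve d = {proj_rel d `` {veronese_vec d x} | x. x \<in> proj_reps 1}"

end

theory Submission
  imports Defs "Jordan_Normal_Form.Determinant"
begin

text \<open>
  Let the ideal of \<open>X\<close> have \<open>r \<le> d\<close> homogeneous generators; by comparing them with linear and
  quadratic forms that vanish on \<open>X\<close> one bounds \<open>r\<close> from below. Any \<open>d + 1\<close> points of the curve
  are linearly independent. So if \<open>X\<close> consists of \<open>n \<le> d + 1\<close> points, there must be at least
  \<open>d + 1 - n\<close> linear generators and at least \<open>n choose 2\<close> quadratic ones, whence \<open>n \<le> 2\<close>.
  If \<open>X\<close> has more points, no linear form vanishes on it, and the \<open>d choose 2\<close> independent quadrics
  through the curve require as many quadratic generators. As \<open>d \<le> d choose 2 \<le> r \<le> d\<close>, the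
  generators are then combinations of these quadrics, so \<open>X\<close> is the whole curve; but that has
  codimension at most \<open>d - 1 < r\<close>.
\<close>

section \<open>Evaluation of polynomials\<close>

text \<open>Names the inner product of \<open>mpoly_eval\<close>, so that multiplicativity in the
  monomial can be stated on its own.\<close>

definition monom_eval :: "'k::field vec \<Rightarrow> (nat \<Rightarrow>\<^sub>0 nat) \<Rightarrow> 'k" where
  "monom_eval v m = (\<Prod>i\<in>Poly_Mapping.keys m. v $ i ^ Poly_Mapping.lookup m i)"

text \<open>Indices outside the support have exponent 0 and contribute a factor 1. Over a common
  index set two monomials can be compared factor by factor.\<close>

lemma monom_eval_superset:
  assumes "finite S" "Poly_Mapping.keys m \<subseteq> S"
  shows "monom_eval v m = (\<Prod>i\<in>S. v $ i ^ Poly_Mapping.lookup m i)"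
  unfolding monom_eval_def
  by (rule prod.mono_neutral_left) (use assms in \<open>auto simp: in_keys_iff\<close>)

lemma monom_eval_0 [simp]: "monom_eval v 0 = 1"
  by (simp add: monom_eval_def)

lemma monom_eval_add: "monom_eval v (m + n) = monom_eval v m * monom_eval v n"
proof -
  let ?S = "Poly_Mapping.keys m \<union> Poly_Mapping.keys n"
  have "monom_eval v (m + n) = (\<Prod>i\<in>?S. v $ i ^ Poly_Mapping.lookup (m + n) i)"
    by (rule monom_eval_superset) (auto dest: subsetD[OF Poly_Mapping.keys_add])
  also have "\<dots> = (\<Prod>i\<in>?S. v $ i ^ Poly_Mapping.lookup m i) * (\<Prod>i\<in>?S. v $ i ^ Poly_Mapping.lookup n i)"
    by (simp add: lookup_add power_add prod.distrib)
  also have "\<dots> = monom_eval v m * monom_eval v n"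
    by (subst (1 2) monom_eval_superset[of ?S]) auto
  finally show ?thesis .
qed

lemma mpoly_eval_superset:
  assumes "finite S" "Poly_Mapping.keys p \<subseteq> S"
  shows "mpoly_eval v p = (\<Sum>m\<in>S. Poly_Mapping.lookup p m * monom_eval v m)"
  unfolding mpoly_eval_def monom_eval_def[symmetric]
  by (rule sum.mono_neutral_left) (use assms in \<open>auto simp: in_keys_iff\<close>)

lemma mpoly_eval_0 [simp]: "mpoly_eval v 0 = 0"
  by (simp add: mpoly_eval_def)

lemma mpoly_eval_single [simp]:
  "mpoly_eval v (Poly_Mapping.single m c) = c * monom_eval v m"
  by (subst mpoly_eval_superset[of "{m}"]) auto

lemma mpoly_eval_add [simp]: "mpoly_eval v (p + q) = mpoly_eval v p + mpoly_eval v q"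
proof -
  let ?S = "Poly_Mapping.keys p \<union> Poly_Mapping.keys q"
  show ?thesis
    by (subst (1 2 3) mpoly_eval_superset[of ?S])
      (auto simp: lookup_add sum.distrib distrib_right dest: subsetD[OF Poly_Mapping.keys_add])
qed

lemma mpoly_eval_uminus [simp]: "mpoly_eval v (- p) = - mpoly_eval v p"
  by (simp add: mpoly_eval_def sum_negf)

lemma mpoly_eval_diff [simp]: "mpoly_eval v (p - q) = mpoly_eval v p - mpoly_eval v q"
  using mpoly_eval_add[of v p "- q"] by simp

lemma mpoly_eval_sum [simp]: "mpoly_eval v (\<Sum>i\<in>A. f i) = (\<Sum>i\<in>A. mpoly_eval v (f i))"
  by (induction A rule: infinite_finite_induct) auto

lemma mpoly_as_sum:
  "p = (\<Sum>m\<in>Poly_Mapping.keys p. Poly_Mapping.single m (Poly_Mapping.lookup p m))"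
  by (rule poly_mapping_eqI) (auto simp: lookup_sum lookup_single when_def in_keys_iff)

lemma mpoly_eval_mult [simp]: "mpoly_eval v (p * q) = mpoly_eval v p * mpoly_eval v q"
proof -
  have "p * q = (\<Sum>m\<in>Poly_Mapping.keys p. \<Sum>n\<in>Poly_Mapping.keys q.
      Poly_Mapping.single (m + n) (Poly_Mapping.lookup p m * Poly_Mapping.lookup q n))"
    by (subst mpoly_as_sum[of p], subst mpoly_as_sum[of q]) (simp add: sum_product mult_single)
  then have "mpoly_eval v (p * q) = (\<Sum>m\<in>Poly_Mapping.keys p. \<Sum>n\<in>Poly_Mapping.keys q.
      Poly_Mapping.lookup p m * Poly_Mapping.lookup q n * (monom_eval v m * monom_eval v n))"
    by (simp add: monom_eval_add)
  also have "\<dots> = mpoly_eval v p * mpoly_eval v q"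
    unfolding mpoly_eval_def monom_eval_def[symmetric]
    by (simp add: sum_product mult_ac)
  finally show ?thesis .
qed

lemma mpoly_eval_prod [simp]:
  "finite A \<Longrightarrow> mpoly_eval v (\<Prod>i\<in>A. f i) = (\<Prod>i\<in>A. mpoly_eval v (f i))"
  by (induction A rule: finite_induct) (auto simp flip: single_one)

section \<open>Variables, linear forms and membership in the coordinate ring\<close>

definition mvar :: "nat \<Rightarrow> 'k::field mpoly" where
  "mvar i = Poly_Mapping.single (Poly_Mapping.single i 1) 1"

lemma mpoly_eval_mvar [simp]: "mpoly_eval v (mvar i) = v $ i"
  by (simp add: mvar_def monom_eval_def)

definition linear_form :: "nat \<Rightarrow> (nat \<Rightarrow> 'k::field) \<Rightarrow> 'k mpoly" where
  "linear_form d c = (\<Sum>k\<le>d. Poly_Mapping.single 0 (c k) * mvar k)"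

lemma mpoly_eval_linear_form [simp]:
  "mpoly_eval v (linear_form d c) = (\<Sum>k\<le>d. c k * v $ k)"
  by (simp add: linear_form_def)

lemma coord_ring_mvar: "i \<le> d \<Longrightarrow> mvar i \<in> coord_ring d"
  by (auto simp: coord_ring_def mvar_def)

lemma coord_ring_const: "Poly_Mapping.single 0 c \<in> coord_ring d"
  by (auto simp: coord_ring_def)

lemma coord_ring_add:
  assumes "p \<in> coord_ring d" "q \<in> coord_ring d"
  shows "p + q \<in> coord_ring d"
  using subsetD[OF Poly_Mapping.keys_add, of _ p q] assms by (auto simp: coord_ring_def)

lemma coord_ring_diff:
  assumes "p \<in> coord_ring d" "q \<in> coord_ring d"
  shows "p - q \<in> coord_ring d"
  using subsetD[OF keys_diff, of _ p q] assms unfolding coord_ring_def by blast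

lemma coord_ring_mult:
  assumes "p \<in> coord_ring d" "q \<in> coord_ring d"
  shows "p * q \<in> coord_ring d"
  unfolding coord_ring_def
proof (intro CollectI ballI subsetI)
  fix m i assume "m \<in> Poly_Mapping.keys (p * q)" and i: "i \<in> Poly_Mapping.keys m"
  then obtain a b where "m = a + b" "a \<in> Poly_Mapping.keys p" "b \<in> Poly_Mapping.keys q"
    using subsetD[OF keys_mult] by blast
  then show "i \<in> {..d}"
    using assms i subsetD[OF Poly_Mapping.keys_add, of i a b] unfolding coord_ring_def by blast
qed

lemma coord_ring_sum:
  assumes "\<And>i. i \<in> A \<Longrightarrow> f i \<in> coord_ring d"
  shows "sum f A \<in> coord_ring d"
proof -
  have "0 \<in> coord_ring d"
    using coord_ring_const[of 0 d] by simp
  then show ?thesis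
    using assms by (induction A rule: infinite_finite_induct) (auto intro: coord_ring_add)
qed

lemma coord_ring_prod:
  assumes "\<And>i. i \<in> A \<Longrightarrow> f i \<in> coord_ring d"
  shows "prod f A \<in> coord_ring d"
proof -
  have "1 \<in> coord_ring d"
    using coord_ring_const[of 1 d] by simp
  then show ?thesis
    using assms by (induction A rule: infinite_finite_induct) (auto intro: coord_ring_mult)
qed

lemma coord_ring_linear_form: "linear_form d c \<in> coord_ring d"
  unfolding linear_form_def
  by (intro coord_ring_sum coord_ring_mult coord_ring_const coord_ring_mvar) simp

section \<open>Homogeneous polynomials and restriction to parametrised curves\<close>

lemma monom_eval_smult:
  assumes "v \<in> carrier_vec (Suc d)" "Poly_Mapping.keys m \<subseteq> {..d}"
  shows "monom_eval (c \<cdot>\<^sub>v v) m = c ^ (\<Sum>i\<in>Poly_Mapping.keys m. Poly_Mapping.lookup m i) * monom_eval v m"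
proof -
  have "monom_eval (c \<cdot>\<^sub>v v) m = (\<Prod>i\<in>Poly_Mapping.keys m. (c * v $ i) ^ Poly_Mapping.lookup m i)"
    unfolding monom_eval_def by (rule prod.cong) (use assms in auto)
  then show ?thesis
    by (simp add: power_mult_distrib prod.distrib power_sum monom_eval_def)
qed

lemma mpoly_eval_smult:
  assumes "v \<in> carrier_vec (Suc d)" "p \<in> coord_ring d" "homogeneous e p"
  shows "mpoly_eval (c \<cdot>\<^sub>v v) p = c ^ e * mpoly_eval v p"
proof -
  have "mpoly_eval (c \<cdot>\<^sub>v v) p
      = (\<Sum>m\<in>Poly_Mapping.keys p. c ^ e * (Poly_Mapping.lookup p m * monom_eval v m))"
    unfolding mpoly_eval_def monom_eval_def[symmetric]
  proof (rule sum.cong[OF refl])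
    fix m assume m: "m \<in> Poly_Mapping.keys p"
    then have "Poly_Mapping.keys m \<subseteq> {..d}" "(\<Sum>i\<in>Poly_Mapping.keys m. Poly_Mapping.lookup m i) = e"
      using assms by (auto simp: coord_ring_def homogeneous_def)
    then show "Poly_Mapping.lookup p m * monom_eval (c \<cdot>\<^sub>v v) m
        = c ^ e * (Poly_Mapping.lookup p m * monom_eval v m)"
      using monom_eval_smult[OF assms(1), of m c] by simp
  qed
  then show ?thesis
    by (simp add: mpoly_eval_def monom_eval_def sum_distrib_left)
qed

lemma mpoly_eval_homogeneous_1:
  assumes "p \<in> coord_ring d" "homogeneous 1 p"
  obtains c where "\<And>v. mpoly_eval v p = (\<Sum>k\<le>d. c k * v $ k)"
proof -
  \<comment> \<open>A monomial of degree 1 is a single variable: any exponent in its support is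
    nonzero, hence 1, and all others are 0.\<close>
  have *: "\<exists>i\<le>d. m = Poly_Mapping.single i 1" if "m \<in> Poly_Mapping.keys p" for m
  proof -
    have s: "(\<Sum>i\<in>Poly_Mapping.keys m. Poly_Mapping.lookup m i) = 1" and k: "Poly_Mapping.keys m \<subseteq> {..d}"
      using assms that by (auto simp: homogeneous_def coord_ring_def)
    then obtain i where i: "i \<in> Poly_Mapping.keys m" by force
    have "(\<Sum>j\<in>Poly_Mapping.keys m - {i}. Poly_Mapping.lookup m j) + Poly_Mapping.lookup m i = 1"
      using s i by (simp add: sum.remove)
    moreover have "Poly_Mapping.lookup m i \<noteq> 0" using i by (simp add: in_keys_iff)
    ultimately have m1: "Poly_Mapping.lookup m i = 1"
      and "(\<Sum>j\<in>Poly_Mapping.keys m - {i}. Poly_Mapping.lookup m j) = 0" by linarith+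
    then have "\<forall>j\<in>Poly_Mapping.keys m - {i}. Poly_Mapping.lookup m j = 0" by simp
    then have "m = Poly_Mapping.single i 1"
      by (intro poly_mapping_eqI) (use m1 in \<open>auto simp: lookup_single when_def in_keys_iff\<close>)
    then show ?thesis using i k by auto
  qed
  let ?c = "\<lambda>i. Poly_Mapping.lookup p (Poly_Mapping.single i 1)"
  have inj: "inj_on (\<lambda>i. Poly_Mapping.single i (1::nat)) {..d}"
    by (auto simp: inj_on_def poly_mapping_eq_iff lookup_single fun_eq_iff when_def)
  have "mpoly_eval v p = (\<Sum>k\<le>d. ?c k * v $ k)" for v
  proof -
    have "mpoly_eval v p
        = (\<Sum>m\<in>(\<lambda>i. Poly_Mapping.single i 1) ` {..d}. Poly_Mapping.lookup p m * monom_eval v m)"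
      by (rule mpoly_eval_superset) (use * in auto)
    also have "\<dots> = (\<Sum>k\<le>d. ?c k * v $ k)"
      by (subst sum.reindex[OF inj]) (simp add: monom_eval_def)
    finally show ?thesis .
  qed
  then show thesis by (rule that)
qed

text \<open>The witness is the formal substitution of the \<open>w i\<close> for the variables. It
  makes one-variable polynomials available on lines through the origin and on the two charts of the
  rational normal curve.\<close>

lemma mpoly_eval_poly_curve:
  assumes "p \<in> coord_ring d"
  shows "\<exists>P. \<forall>t. mpoly_eval (vec (Suc d) (\<lambda>i. poly (w i) t)) p = poly P t"
proof (intro exI allI)
  fix t
  have "monom_eval (vec (Suc d) (\<lambda>i. poly (w i) t)) m
      = poly (\<Prod>i\<in>Poly_Mapping.keys m. w i ^ Poly_Mapping.lookup m i) t"
    if "m \<in> Poly_Mapping.keys p" for m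
  proof -
    have "Poly_Mapping.keys m \<subseteq> {..d}"
      using that assms by (auto simp: coord_ring_def)
    then show ?thesis
      unfolding monom_eval_def poly_prod poly_power by (intro prod.cong) auto
  qed
  then show "mpoly_eval (vec (Suc d) (\<lambda>i. poly (w i) t)) p
      = poly (\<Sum>m\<in>Poly_Mapping.keys p. Polynomial.smult (Poly_Mapping.lookup p m)
          (\<Prod>i\<in>Poly_Mapping.keys m. w i ^ Poly_Mapping.lookup m i)) t"
    unfolding mpoly_eval_def monom_eval_def[symmetric] poly_sum poly_smult
    by (intro sum.cong) auto
qed

section \<open>Generators of given degree\<close>

text \<open>Restrict \<open>Q = \<Sum>\<^sub>i a\<^sub>i F\<^sub>i\<close> to the line \<open>t \<cdot> v\<close> and compare coefficients of \<open>t\<^sup>n\<close>: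
  the coefficients \<open>\<alpha>\<^sub>i = a\<^sub>i(0)\<close> do not depend on \<open>v\<close>.\<close>

lemma ideal_generated_degree_part:
  fixes F :: "nat \<Rightarrow> 'k::field_char_0 mpoly"
  assumes F: "\<And>i. i < r \<Longrightarrow> F i \<in> coord_ring d \<and> homogeneous (e i) (F i)"
    and Q: "Q \<in> ideal_generated d r F"
    and hom: "\<And>v t. v \<in> carrier_vec (Suc d) \<Longrightarrow> mpoly_eval (t \<cdot>\<^sub>v v) Q = t ^ n * mpoly_eval v Q"
  shows "\<exists>\<alpha>. \<forall>v\<in>carrier_vec (Suc d). (\<forall>i<r. e i < n \<longrightarrow> mpoly_eval v (F i) = 0) \<longrightarrow>
    mpoly_eval v Q = (\<Sum>i | i < r \<and> e i = n. \<alpha> i * mpoly_eval v (F i))"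
proof -
  obtain a where Qa: "Q = (\<Sum>i<r. a i * F i)" and a: "\<And>i. i < r \<Longrightarrow> a i \<in> coord_ring d"
    using Q by (auto simp: ideal_generated_def)
  let ?\<alpha> = "\<lambda>i. mpoly_eval (0\<^sub>v (Suc d)) (a i)"
  have "mpoly_eval v Q = (\<Sum>i | i < r \<and> e i = n. ?\<alpha> i * mpoly_eval v (F i))"
    if v: "v \<in> carrier_vec (Suc d)" and low: "\<And>i. i < r \<Longrightarrow> e i < n \<Longrightarrow> mpoly_eval v (F i) = 0" for v
  proof -
    have "\<exists>A. \<forall>t. mpoly_eval (t \<cdot>\<^sub>v v) (a i) = poly A t" if i: "i < r" for i
    proof -
      obtain A where A: "\<forall>t. mpoly_eval (vec (Suc d) (\<lambda>j. poly [:0, v $ j:] t)) (a i) = poly A t"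
        using mpoly_eval_poly_curve[OF a[OF i], where w = "\<lambda>j. [:0, v $ j:]"] by (rule exE)
      have eq: "vec (Suc d) (\<lambda>j. poly [:0, v $ j:] t) = t \<cdot>\<^sub>v v" for t
        using v by (intro eq_vecI) auto
      show ?thesis using A unfolding eq by (rule exI)
    qed
    then have "\<forall>i\<in>{..<r}. \<exists>A. \<forall>t. mpoly_eval (t \<cdot>\<^sub>v v) (a i) = poly A t" by blast
    from bchoice[OF this] obtain A
      where A: "\<And>i t. i < r \<Longrightarrow> mpoly_eval (t \<cdot>\<^sub>v v) (a i) = poly (A i) t" by blast
    have \<alpha>: "coeff (A i) 0 = ?\<alpha> i" if "i < r" for i
    proof -
      have "0 \<cdot>\<^sub>v v = 0\<^sub>v (Suc d)" using v by (intro eq_vecI) auto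
      then show ?thesis using A[OF that, of 0] by (simp add: poly_0_coeff_0)
    qed
    have "poly (monom (mpoly_eval v Q) n) t
        = poly (\<Sum>i<r. A i * monom (mpoly_eval v (F i)) (e i)) t" for t
    proof -
      have "poly (monom (mpoly_eval v Q) n) t = mpoly_eval (t \<cdot>\<^sub>v v) Q"
        using hom[OF v] by (simp add: poly_monom)
      also have "\<dots> = (\<Sum>i<r. poly (A i) t * (t ^ e i * mpoly_eval v (F i)))"
        unfolding Qa mpoly_eval_sum mpoly_eval_mult
      proof (rule sum.cong[OF refl])
        fix i assume "i \<in> {..<r}"
        then show "mpoly_eval (t \<cdot>\<^sub>v v) (a i) * mpoly_eval (t \<cdot>\<^sub>v v) (F i)
            = poly (A i) t * (t ^ e i * mpoly_eval v (F i))"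
          using F[of i] mpoly_eval_smult[OF v, of "F i" "e i" t] A[of i t] by simp
      qed
      finally show ?thesis by (simp add: poly_sum poly_monom mult.commute)
    qed
    \<comment> \<open>The field is infinite, so equality for all \<open>t\<close> is an identity of
      polynomials.\<close>
    then have "monom (mpoly_eval v Q) n = (\<Sum>i<r. A i * monom (mpoly_eval v (F i)) (e i))"
      by (simp add: poly_eq_poly_eq_iff[symmetric] fun_eq_iff)
    then have "coeff (monom (mpoly_eval v Q) n) n
        = coeff (\<Sum>i<r. A i * monom (mpoly_eval v (F i)) (e i)) n" by simp
    then have "mpoly_eval v Q = (\<Sum>i<r. coeff (monom (mpoly_eval v (F i)) (e i) * A i) n)"
      by (simp add: coeff_sum mult.commute)
    \<comment> \<open>Generators of degree below \<open>n\<close> vanish at \<open>v\<close>, those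
      of degree above \<open>n\<close> have no term in \<open>t^n\<close>, and in degree
      \<open>n\<close> only the constant coefficient of \<open>A i\<close> remains.\<close>
    also have "\<dots> = (\<Sum>i<r. if e i = n then ?\<alpha> i * mpoly_eval v (F i) else 0)"
    proof (rule sum.cong[OF refl])
      fix i assume i: "i \<in> {..<r}"
      show "coeff (monom (mpoly_eval v (F i)) (e i) * A i) n
          = (if e i = n then ?\<alpha> i * mpoly_eval v (F i) else 0)"
        using low[of i] \<alpha>[of i] i by (cases "e i" n rule: linorder_cases) (auto simp: coeff_monom_mult)
    qed
    also have "\<dots> = (\<Sum>i | i < r \<and> e i = n. ?\<alpha> i * mpoly_eval v (F i))"
      by (subst sum.inter_filter[symmetric]) simp_all
    finally show ?thesis .
  qed
  then show ?thesis by (intro exI[of _ ?\<alpha>]) blast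
qed

text \<open>Pad both matrices to squares: a square left inverse is a right inverse, which rules out
  zero columns.\<close>

lemma left_inverse_card:
  fixes c :: "'a \<Rightarrow> 'b \<Rightarrow> 'k::field"
  assumes "finite I" "finite B"
    and inv: "\<And>i j. i \<in> I \<Longrightarrow> j \<in> I \<Longrightarrow> (\<Sum>k\<in>B. c i k * f k j) = (if i = j then 1 else 0)"
  shows "card I \<le> card B"
    and "card I = card B \<Longrightarrow> k \<in> B \<Longrightarrow> l \<in> B \<Longrightarrow> (\<Sum>i\<in>I. f k i * c i l) = (if k = l then 1 else 0)"
proof -
  obtain g h where g: "bij_betw g {..<card I} I" and h: "bij_betw h {..<card B} B"
    using ex_bij_betw_nat_finite[OF assms(1)] ex_bij_betw_nat_finite[OF assms(2)]
    by (auto simp: atLeast0LessThan)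
  have gI: "g i \<in> I" if "i < card I" for i using g that by (auto simp: bij_betw_def)
  have hB: "h i \<in> B" if "i < card B" for i using h that by (auto simp: bij_betw_def)
  have ginj: "g i = g j \<longleftrightarrow> i = j" if "i < card I" "j < card I" for i j
    using g that by (auto simp: bij_betw_def inj_on_def)
  have hinj: "h i = h j \<longleftrightarrow> i = j" if "i < card B" "j < card B" for i j
    using h that by (auto simp: bij_betw_def inj_on_def)
  define n where "n = card I"
  \<comment> \<open>Zero padding replaces the index set \<open>B\<close> by one of the size of
    \<open>I\<close>; this requires \<open>card B \<le> n\<close>, which \<open>inverse\<close>
    assumes.\<close>
  define C where "C = mat n n (\<lambda>(i, k). if k < card B then c (g i) (h k) else 0)"
  define D where "D = mat n n (\<lambda>(k, j). if k < card B then f (h k) (g j) else 0)"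
  have inverse: "D * C = 1\<^sub>m n" if le: "card B \<le> n"
  proof -
    have "C * D = 1\<^sub>m n"
    proof (rule eq_matI)
      fix i j assume "i < dim_row (1\<^sub>m n)" "j < dim_col (1\<^sub>m n)"
      then have ij: "i < n" "j < n" by auto
      have "(C * D) $$ (i, j) = (\<Sum>k = 0..<n. if k < card B then c (g i) (h k) * f (h k) (g j) else 0)"
        using ij by (auto simp: C_def D_def scalar_prod_def intro!: sum.cong)
      also have "\<dots> = (\<Sum>k<card B. c (g i) (h k) * f (h k) (g j))"
        by (rule sum.mono_neutral_cong_right) (use le in auto)
      also have "\<dots> = (\<Sum>k\<in>B. c (g i) k * f k (g j))"
        by (rule sum.reindex_bij_betw[OF h])
      finally show "(C * D) $$ (i, j) = 1\<^sub>m n $$ (i, j)"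
        using ij inv gI ginj by (simp add: n_def)
    qed (auto simp: C_def D_def)
    then show ?thesis
      by (intro mat_mult_left_right_inverse[of C n D]) (auto simp: C_def D_def)
  qed
  show "card I \<le> card B"
  proof (rule ccontr)
    assume "\<not> card I \<le> card B"
    then have lt: "card B < n" by (simp add: n_def)
    \<comment> \<open>The index \<open>card B\<close> lies in the padding, so this diagonal entry is
      0, while the identity matrix has 1 there.\<close>
    have "(D * C) $$ (card B, card B) = 0"
      using lt by (simp add: C_def D_def scalar_prod_def)
    then show False using inverse lt by simp
  qed
  assume eq: "card I = card B" and kl: "k \<in> B" "l \<in> B"
  obtain k' l' where k': "k' < card B" "h k' = k" and l': "l' < card B" "h l' = l"
    using h kl unfolding bij_betw_def by (metis imageE lessThan_iff)
  have "(\<Sum>i\<in>I. f k i * c i l) = (\<Sum>i<n. f k (g i) * c (g i) l)"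
    unfolding n_def by (rule sum.reindex_bij_betw[OF g, symmetric])
  also have "\<dots> = (D * C) $$ (k', l')"
    using k' l' eq by (simp add: C_def D_def scalar_prod_def n_def lessThan_atLeast0)
  finally show "(\<Sum>i\<in>I. f k i * c i l) = (if k = l then 1 else 0)"
    using inverse eq k' l' hinj[of k' l'] by (auto simp: n_def)
qed

section \<open>The rational normal curve\<close>

definition curve_point :: "nat \<Rightarrow> 'k::field vec \<Rightarrow> 'k vec set" where
  "curve_point d x = proj_rel d `` {veronese_vec d x}"

lemma rational_normal_curve_eq: "rational_normal_curve d = curve_point d ` proj_reps 1"
  by (auto simp: rational_normal_curve_def curve_point_def)

lemma veronese_vec_carrier [simp]: "veronese_vec d x \<in> carrier_vec (Suc d)"
  by (simp add: veronese_vec_def)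

lemma veronese_vec_index [simp]: "k \<le> d \<Longrightarrow> veronese_vec d x $ k = x $ 0 ^ (d - k) * x $ 1 ^ k"
  by (simp add: veronese_vec_def)

lemma veronese_vec_smult:
  assumes "x \<in> proj_reps 1"
  shows "veronese_vec d (c \<cdot>\<^sub>v x) = c ^ d \<cdot>\<^sub>v veronese_vec d x"
proof -
  have dim: "dim_vec x = 2"
    using assms unfolding proj_reps_def by auto
  have eq: "(c * x $ 0) ^ (d - i) * (c * x $ 1) ^ i = c ^ d * (x $ 0 ^ (d - i) * x $ 1 ^ i)"
    if "i \<le> d" for i
  proof -
    have "(c * x $ 0) ^ (d - i) * (c * x $ 1) ^ i = c ^ (d - i + i) * (x $ 0 ^ (d - i) * x $ 1 ^ i)"
      unfolding power_mult_distrib power_add by (simp only: mult_ac)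
    then show ?thesis using that by simp
  qed
  show ?thesis
    by (rule eq_vecI) (use dim eq in \<open>simp_all add: veronese_vec_def\<close>)
qed

lemma proj_reps_1_nonzero:
  assumes "x \<in> proj_reps 1"
  shows "x $ 0 \<noteq> 0 \<or> x $ 1 \<noteq> 0"
proof (rule ccontr)
  assume "\<not> ?thesis"
  then have "x = 0\<^sub>v 2"
    using assms by (intro eq_vecI) (auto simp: proj_reps_def less_2_cases_iff)
  then show False using assms by (simp add: proj_reps_def numeral_2_eq_2)
qed

text \<open>The first and the last coordinate are the \<open>d\<close>-th powers of the two
  coordinates of \<open>x\<close>, which are not both zero.\<close>

lemma veronese_vec_proj_reps:
  assumes "x \<in> proj_reps 1"
  shows "veronese_vec d x \<in> proj_reps d"
proof -
  have "veronese_vec d x $ 0 = x $ 0 ^ d" "veronese_vec d x $ d = x $ 1 ^ d"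
    by simp_all
  then have "veronese_vec d x $ 0 \<noteq> 0 \<or> veronese_vec d x $ d \<noteq> 0"
    using proj_reps_1_nonzero[OF assms] by (metis power_not_zero)
  then have "veronese_vec d x \<noteq> 0\<^sub>v (Suc d)"
    by (metis index_zero_vec(1) lessI zero_less_Suc)
  then show ?thesis by (simp add: proj_reps_def)
qed

lemma proj_class_iff:
  assumes "w \<in> proj_reps d"
  shows "v \<in> proj_rel d `` {w} \<longleftrightarrow> (\<exists>c. c \<noteq> 0 \<and> v = c \<cdot>\<^sub>v w)"
proof -
  have "c \<cdot>\<^sub>v w \<in> proj_reps d" if "c \<noteq> 0" for c
  proof -
    have "c \<cdot>\<^sub>v w \<noteq> 0\<^sub>v (Suc d)"
    proof
      assume "c \<cdot>\<^sub>v w = 0\<^sub>v (Suc d)"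
      then have "inverse c \<cdot>\<^sub>v (c \<cdot>\<^sub>v w) = 0\<^sub>v (Suc d)" by auto
      then show False using that assms by (simp add: smult_smult_assoc proj_reps_def)
    qed
    then show ?thesis using assms by (simp add: proj_reps_def)
  qed
  then show ?thesis using assms by (auto simp: proj_rel_def)
qed

lemma curve_point_iff:
  "x \<in> proj_reps 1 \<Longrightarrow> v \<in> curve_point d x \<longleftrightarrow> (\<exists>c. c \<noteq> 0 \<and> v = c \<cdot>\<^sub>v veronese_vec d x)"
  unfolding curve_point_def by (rule proj_class_iff[OF veronese_vec_proj_reps])

lemma veronese_vec_in_curve_point: "x \<in> proj_reps 1 \<Longrightarrow> veronese_vec d x \<in> curve_point d x"
  by (auto simp: curve_point_iff intro!: exI[of _ 1])

lemma curve_point_eqI: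
  assumes "x \<in> proj_reps 1" "y \<in> proj_reps 1" "veronese_vec d y = c \<cdot>\<^sub>v veronese_vec d x" "c \<noteq> 0"
  shows "curve_point d x = curve_point d y"
  unfolding curve_point_def
  by (rule equiv_class_eq[OF equiv_proj_rel])
    (use assms veronese_vec_proj_reps[OF assms(1), of d] veronese_vec_proj_reps[OF assms(2), of d]
      in \<open>auto simp: proj_rel_def\<close>)

text \<open>A vanishing determinant makes the two coordinate vectors proportional. Contrapositively,
  distinct points of the curve have nonzero determinants, and these are the factors of the dual
  linear forms.\<close>

lemma curve_point_eq_of_det:
  assumes x: "x \<in> proj_reps 1" and y: "y \<in> proj_reps 1" and det: "x $ 0 * y $ 1 = x $ 1 * y $ 0"
  shows "curve_point d x = curve_point d y"
proof -
  have "\<exists>c. c \<noteq> 0 \<and> y = c \<cdot>\<^sub>v x"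
  proof (cases "x $ 0 = 0")
    case True
    then have x1: "x $ 1 \<noteq> 0" using proj_reps_1_nonzero[OF x] by auto
    then have y0: "y $ 0 = 0" using det True by simp
    then have "y $ 1 \<noteq> 0" using proj_reps_1_nonzero[OF y] by auto
    moreover have "y = (y $ 1 / x $ 1) \<cdot>\<^sub>v x"
      using x y x1 y0 True by (intro eq_vecI) (auto simp: proj_reps_def less_Suc_eq)
    ultimately show ?thesis using x1 by (intro exI[of _ "y $ 1 / x $ 1"]) auto
  next
    case False
    then have y1: "y $ 1 = (y $ 0 / x $ 0) * x $ 1" using det by (simp add: field_simps)
    then have "y $ 0 \<noteq> 0" using proj_reps_1_nonzero[OF y] by auto
    moreover have "y = (y $ 0 / x $ 0) \<cdot>\<^sub>v x"
      using x y False y1 by (intro eq_vecI) (auto simp: proj_reps_def less_Suc_eq)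
    ultimately show ?thesis using False by (intro exI[of _ "y $ 0 / x $ 0"]) auto
  qed
  then obtain c where "c \<noteq> 0" "y = c \<cdot>\<^sub>v x" by auto
  then show ?thesis
    using x y by (intro curve_point_eqI[where c = "c ^ d"]) (auto simp: veronese_vec_smult)
qed

text \<open>The values at two representatives differ by a nonzero factor \<open>c^e\<close>, so one
  representative decides.\<close>

lemma vanishes_at_curve_point:
  assumes "x \<in> proj_reps 1" "p \<in> coord_ring d" "homogeneous e p"
  shows "vanishes_at p (curve_point d x) \<longleftrightarrow> mpoly_eval (veronese_vec d x) p = 0"
  unfolding vanishes_at_def
  using assms(1) veronese_vec_in_curve_point[OF assms(1)]
    mpoly_eval_smult[OF veronese_vec_carrier assms(2,3)]
  by (auto simp: curve_point_iff)

section \<open>Affine parameter and point at infinity\<close>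

definition affine_rep :: "'k::field \<Rightarrow> 'k vec" where
  "affine_rep t = vec 2 (\<lambda>i. if i = 0 then 1 else t)"

definition infinity_rep :: "'k::field vec" where
  "infinity_rep = vec 2 (\<lambda>i. if i = 0 then 0 else 1)"

lemma affine_rep_index [simp]: "affine_rep t $ 0 = 1" "affine_rep t $ Suc 0 = t"
  by (simp_all add: affine_rep_def)

lemma infinity_rep_index [simp]: "infinity_rep $ 0 = 0" "infinity_rep $ Suc 0 = 1"
  by (simp_all add: infinity_rep_def)

lemma affine_rep_proj_reps [simp]: "affine_rep t \<in> proj_reps (Suc 0)"
proof -
  have "affine_rep t \<noteq> 0\<^sub>v 2"
    using affine_rep_index(1)[of t] by (metis index_zero_vec(1) zero_less_numeral zero_neq_one)
  then show ?thesis by (simp add: proj_reps_def affine_rep_def numeral_2_eq_2)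
qed

lemma infinity_rep_proj_reps [simp]: "infinity_rep \<in> proj_reps (Suc 0)"
proof -
  have "infinity_rep \<noteq> (0\<^sub>v 2 :: 'a vec)"
    using infinity_rep_index(2) by (metis index_zero_vec(1) one_less_numeral_iff semiring_norm(76) One_nat_def zero_neq_one)
  then show ?thesis by (simp add: proj_reps_def infinity_rep_def numeral_2_eq_2)
qed

text \<open>Dividing by the first coordinate, if it is nonzero, yields the parameter
  \<open>t\<close>; otherwise only the point \<open>[0, 1]\<close> of the line remains.\<close>

lemma rational_normal_curve_cases:
  assumes "P \<in> rational_normal_curve d"
  obtains "P = curve_point d infinity_rep" | t where "P = curve_point d (affine_rep t)"
proof -
  obtain x where x: "x \<in> proj_reps 1" "P = curve_point d x"
    using assms by (auto simp: rational_normal_curve_eq)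
  show thesis
  proof (cases "x $ 0 = 0")
    case True
    then show thesis
      using that(1) x curve_point_eq_of_det[of x infinity_rep d] by simp
  next
    case False
    then show thesis
      using that(2)[of "x $ 1 / x $ 0"] x curve_point_eq_of_det[of x "affine_rep (x $ 1 / x $ 0)" d] by simp
  qed
qed

lemma inj_curve_point_affine:
  assumes "d \<ge> 1"
  shows "inj (\<lambda>t. curve_point d (affine_rep t))"
proof (rule injI)
  fix s t :: 'a assume "curve_point d (affine_rep s) = curve_point d (affine_rep t)"
  then have "veronese_vec d (affine_rep s) \<in> curve_point d (affine_rep t)"
    using veronese_vec_in_curve_point[of "affine_rep s" d] by simp
  then obtain c where c: "veronese_vec d (affine_rep s) = c \<cdot>\<^sub>v veronese_vec d (affine_rep t)"
    by (auto simp: curve_point_iff)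
  have *: "veronese_vec d (affine_rep s) $ i = c * veronese_vec d (affine_rep t) $ i" if "i \<le> d" for i
    unfolding c using that by (simp add: veronese_vec_def)
  \<comment> \<open>Coordinate 0 gives \<open>c = 1\<close>; coordinate 1, which exists because
    \<open>d \<ge> 1\<close>, then gives the parameter.\<close>
  show "s = t" using *[of 0] *[of 1] assms by simp
qed

lemma infinite_rational_normal_curve:
  assumes "d \<ge> 1"
  shows "infinite (rational_normal_curve d :: 'k::field_char_0 vec set set)"
proof -
  have "range (\<lambda>t. curve_point d (affine_rep t)) \<subseteq> (rational_normal_curve d :: 'k vec set set)"
    by (auto simp: rational_normal_curve_eq)
  moreover have "infinite (range (\<lambda>t::'k. curve_point d (affine_rep t)))"
    using inj_curve_point_affine[OF assms] infinite_UNIV_char_0 finite_imageD by blast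
  ultimately show ?thesis using finite_subset by blast
qed

text \<open>For the point at infinity put \<open>t = 1 / s\<close>: after scaling by
  \<open>s^d\<close> the coordinates become the polynomials \<open>s^(d - i)\<close>, which give
  that point at \<open>s = 0\<close>. A polynomial vanishing for all nonzero \<open>s\<close> is
  zero.\<close>

lemma vanishes_on_curve:
  fixes p :: "'k::field_char_0 mpoly"
  assumes p: "p \<in> coord_ring d" "homogeneous e p"
    and zero: "\<And>t. mpoly_eval (veronese_vec d (affine_rep t)) p = 0"
    and P: "P \<in> rational_normal_curve d"
  shows "vanishes_at p P"
  using P
proof (cases rule: rational_normal_curve_cases)
  case 1
  obtain R where R: "\<forall>t. mpoly_eval (vec (Suc d) (\<lambda>i. poly (monom 1 (d - i)) t)) p = poly R t"
    using mpoly_eval_poly_curve[OF p(1), where w = "\<lambda>i. monom 1 (d - i)"] by (rule exE)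
  have "poly R s = 0" if s: "s \<noteq> 0" for s
  proof -
    have "vec (Suc d) (\<lambda>i. poly (monom 1 (d - i)) s) = s ^ d \<cdot>\<^sub>v veronese_vec d (affine_rep (1 / s))"
      using s by (intro eq_vecI) (auto simp: veronese_vec_def poly_monom power_diff field_simps)
    then show ?thesis
      using spec[OF R, of s] zero[of "1 / s"] mpoly_eval_smult[OF veronese_vec_carrier p] by simp
  qed
  then have "- {0} \<subseteq> {s. poly R s = 0}" by auto
  moreover have "infinite (- {0 :: 'k})"
    using infinite_UNIV_char_0 by (simp add: Compl_eq_Diff_UNIV)
  ultimately have "R = 0"
    using poly_roots_finite finite_subset by blast
  moreover have "vec (Suc d) (\<lambda>i. poly (monom 1 (d - i)) 0) = veronese_vec d (infinity_rep :: 'k vec)"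
    by (intro eq_vecI) (auto simp: veronese_vec_def poly_monom)
  ultimately have "mpoly_eval (veronese_vec d infinity_rep) p = 0"
    using spec[OF R, of 0] by simp
  then show ?thesis using p 1 by (simp add: vanishes_at_curve_point)
next
  case (2 t)
  then show ?thesis using p zero by (simp add: vanishes_at_curve_point)
qed

text \<open>The point at infinity is not seen by \<open>A\<close>, hence the \<open>Suc\<close> in the bound.\<close>

lemma many_zeros_on_curve:
  assumes p: "p \<in> coord_ring d" "homogeneous e p"
    and A: "\<And>t. mpoly_eval (veronese_vec d (affine_rep t)) p = poly A t"
    and Y: "Y \<subseteq> rational_normal_curve d" "\<And>P. P \<in> Y \<Longrightarrow> vanishes_at p P"
    and card: "infinite Y \<or> card Y > Suc (degree A)"
  shows "A = 0"
proof (rule ccontr)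
  assume "A \<noteq> 0"
  then have fin: "finite {t. poly A t = 0}" and le: "card {t. poly A t = 0} \<le> degree A"
    using poly_roots_finite card_poly_roots_bound by auto
  have "Y \<subseteq> insert (curve_point d infinity_rep) ((\<lambda>t. curve_point d (affine_rep t)) ` {t. poly A t = 0})"
  proof
    fix P assume "P \<in> Y"
    then have "P \<in> rational_normal_curve d" "vanishes_at p P" using Y by auto
    then show "P \<in> insert (curve_point d infinity_rep) ((\<lambda>t. curve_point d (affine_rep t)) ` {t. poly A t = 0})"
      by (cases rule: rational_normal_curve_cases) (use p A in \<open>auto simp: vanishes_at_curve_point\<close>)
  qed
  moreover from fin le have "card (insert (curve_point d infinity_rep)
      ((\<lambda>t. curve_point d (affine_rep t)) ` {t. poly A t = 0})) \<le> Suc (degree A)"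
    by (metis card_image_le card_insert_le_m1 diff_Suc_1 le_trans zero_less_Suc)
  ultimately show False
    using card fin by (meson card_mono finite_imageI finite.insertI finite_subset not_le order_trans)
qed

section \<open>Closed subsets, irreducibility and codimension of the curve\<close>

lemma rational_normal_curve_subset_proj_space: "rational_normal_curve d \<subseteq> proj_space d"
  unfolding rational_normal_curve_def proj_space_def
  by (blast intro: quotientI veronese_vec_proj_reps)

text \<open>In the affine parameter each equation of \<open>Y\<close> is a one-variable polynomial
  with infinitely many zeros, hence zero; so it holds on the whole curve.\<close>

lemma infinite_closed_subset_of_curve:
  fixes Y :: "'k::field_char_0 vec set set"
  assumes "zariski_closed d Y" "Y \<subseteq> rational_normal_curve d" "infinite Y"
  shows "Y = rational_normal_curve d"
proof -
  obtain T where T: "T \<subseteq> coord_ring d" "\<And>p. p \<in> T \<Longrightarrow> \<exists>e. homogeneous e p" "Y = zero_locus d T"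
    using assms(1) by (auto simp: zariski_closed_def)
  have "vanishes_at p P" if p: "p \<in> T" and P: "P \<in> rational_normal_curve d" for p P
  proof -
    obtain e where e: "homogeneous e p" using T(2)[OF p] by auto
    have pd: "p \<in> coord_ring d" using T p by auto
    obtain A where A: "\<forall>t. mpoly_eval (vec (Suc d) (\<lambda>i. poly (monom 1 i) t)) p = poly A t"
      using mpoly_eval_poly_curve[OF pd, where w = "\<lambda>i. monom 1 i"] by (rule exE)
    have "veronese_vec d (affine_rep t) = vec (Suc d) (\<lambda>i. poly (monom 1 i) t)" for t :: 'k
      by (intro eq_vecI) (auto simp: veronese_vec_def poly_monom)
    then have A': "mpoly_eval (veronese_vec d (affine_rep t)) p = poly A t" for t
      using A by simp
    have "vanishes_at p Q" if "Q \<in> Y" for Q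
      using that p T(3) by (auto simp: zero_locus_def)
    then have "A = 0"
      using many_zeros_on_curve[OF pd e A' assms(2)] assms(3) by blast
    then show ?thesis using vanishes_on_curve[OF pd e _ P] A' by simp
  qed
  then show ?thesis
    using T(3) assms(2) subsetD[OF rational_normal_curve_subset_proj_space[of d]]
    by (auto simp: zero_locus_def)
qed

lemma homogeneous_mvar: "homogeneous 1 (mvar i)"
  by (simp add: homogeneous_def mvar_def)

text \<open>The point is \<open>[1, 0, ..., 0]\<close>, cut out by the remaining coordinates. It is
  the smaller member of the chain that bounds the dimension of the curve.\<close>

lemma zariski_closed_curve_point_zero:
  "zariski_closed d {curve_point d (affine_rep (0 :: 'k::field))}"
proof -
  let ?w = "veronese_vec d (affine_rep (0 :: 'k))"
  let ?T = "mvar ` {1..d} :: 'k mpoly set"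
  have w: "?w \<in> proj_reps d"
    by (rule veronese_vec_proj_reps) simp
  have "Z = curve_point d (affine_rep 0)" if Z: "Z \<in> zero_locus d ?T" for Z
  proof -
    obtain v where v: "v \<in> proj_reps d" "Z = proj_rel d `` {v}"
      using Z by (auto simp: zero_locus_def proj_space_def elim: quotientE)
    have "v \<in> Z"
      unfolding v(2) using v(1) by (subst proj_class_iff) (auto intro!: exI[of _ 1])
    then have v0: "v $ j = 0" if "1 \<le> j" "j \<le> d" for j
      using Z that by (auto simp: zero_locus_def vanishes_at_def)
    have dim: "dim_vec v = Suc d"
      using v(1) by (auto simp: proj_reps_def)
    have "v $ 0 \<noteq> 0"
    proof
      assume "v $ 0 = 0"
      then have "v $ j = 0" if "j \<le> d" for j
        using v0[of j] that by (cases "j = 0") auto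
      then have "v = 0\<^sub>v (Suc d)"
        using dim by (intro eq_vecI) auto
      then show False using v(1) by (simp add: proj_reps_def)
    qed
    moreover have "v = v $ 0 \<cdot>\<^sub>v ?w"
    proof (rule eq_vecI)
      fix j assume "j < dim_vec (v $ 0 \<cdot>\<^sub>v ?w)"
      then have "j \<le> d" by (simp add: veronese_vec_def)
      then show "v $ j = (v $ 0 \<cdot>\<^sub>v ?w) $ j"
        using v0[of j] by (cases "j = 0") (auto simp: veronese_vec_def)
    qed (simp add: dim veronese_vec_def)
    ultimately have "(?w, v) \<in> proj_rel d"
      using v(1) w by (auto simp: proj_rel_def)
    then show ?thesis
      unfolding v(2) curve_point_def using equiv_class_eq[OF equiv_proj_rel] by metis
  qed
  moreover have "curve_point d (affine_rep 0) \<in> zero_locus d ?T"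
  proof -
    have "curve_point d (affine_rep 0) \<in> proj_space d"
      using rational_normal_curve_subset_proj_space[of d] by (auto simp: rational_normal_curve_eq)
    moreover have "vanishes_at (mvar j) (curve_point d (affine_rep (0::'k)))" if "1 \<le> j" "j \<le> d" for j
      by (subst vanishes_at_curve_point[OF _ coord_ring_mvar homogeneous_mvar]) (use that in auto)
    ultimately show ?thesis by (auto simp: zero_locus_def)
  qed
  ultimately have "{curve_point d (affine_rep 0)} = zero_locus d ?T" by blast
  moreover have "?T \<subseteq> coord_ring d" using coord_ring_mvar by auto
  moreover have "\<forall>p\<in>?T. \<exists>e. homogeneous e p" using homogeneous_mvar by blast
  ultimately show ?thesis unfolding zariski_closed_def by blast
qed

text \<open>A point and the whole curve form a chain of length 1. The curve is irreducible because,
  of two closed sets whose union it is, one is infinite and hence the whole curve.\<close>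

lemma variety_dim_rational_normal_curve:
  assumes "d \<ge> 1" and closed: "zariski_closed d (rational_normal_curve d :: 'k::field_char_0 vec set set)"
  shows "variety_dim d (rational_normal_curve d :: 'k vec set set) \<ge> 1"
proof -
  let ?C = "rational_normal_curve d :: 'k vec set set"
  let ?P = "curve_point d (affine_rep (0 :: 'k))"
  have inf: "infinite ?C" using infinite_rational_normal_curve assms(1) .
  have comp: "?C = A \<or> ?C = B"
    if "zariski_closed d A" "zariski_closed d B" "?C = A \<union> B" for A B :: "'k vec set set"
  proof -
    have "infinite A \<or> infinite B" using inf that(3) by simp
    then show ?thesis
      using infinite_closed_subset_of_curve[of d A] infinite_closed_subset_of_curve[of d B] that by blast
  qed
  have "?C \<noteq> {}" using inf by auto
  then have C: "irreducible_closed d ?C"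
    unfolding irreducible_closed_def using closed comp by (intro conjI allI impI) simp_all
  have P: "irreducible_closed d {?P}"
    unfolding irreducible_closed_def singleton_Un_iff
    using zariski_closed_curve_point_zero by blast
  have "?P \<in> ?C" by (auto simp: rational_normal_curve_eq)
  moreover have "?C \<noteq> {?P}" using inf by (metis finite.emptyI finite.insertI)
  ultimately have sub: "{?P} \<subset> ?C" by blast
  have "enat 1 \<in> {enat n | n. \<exists>Y. (\<forall>i\<le>n. irreducible_closed d (Y i) \<and> Y i \<subseteq> ?C) \<and>
     (\<forall>i<n. Y i \<subset> Y (Suc i))}"
  proof (intro CollectI exI conjI)
    let ?Y = "\<lambda>i::nat. if i = 0 then {?P} else ?C"
    show "enat 1 = enat 1" ..
    show "\<forall>i\<le>1. irreducible_closed d (?Y i) \<and> ?Y i \<subseteq> ?C" using C P psubset_imp_subset[OF sub] by simp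
    show "\<forall>i<1. ?Y i \<subset> ?Y (Suc i)" using sub by simp
  qed
  then show ?thesis
    unfolding variety_dim_def one_enat_def by (rule Sup_upper)
qed

lemma variety_codim_rational_normal_curve:
  assumes "d \<ge> 1" "zariski_closed d (rational_normal_curve d :: 'k::field_char_0 vec set set)"
  shows "variety_codim d (rational_normal_curve d :: 'k vec set set) \<le> enat (d - 1)"
  \<comment> \<open>Subtraction on \<open>enat\<close> gives 0 when the dimension is infinite, so
    that case satisfies the bound too.\<close>
  using variety_dim_rational_normal_curve[OF assms]
  by (cases "variety_dim d (rational_normal_curve d :: 'k vec set set)")
    (simp_all add: variety_codim_def one_enat_def)

section \<open>Counting generators\<close>

lemma generator_in_ideal_generated:
  fixes F :: "nat \<Rightarrow> 'k::field mpoly"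
  assumes "i < r" "F i \<in> coord_ring d"
  shows "F i \<in> ideal_generated d r F"
proof -
  have "F i = (\<Sum>j<r. (if j = i then 1 else 0) * F j)"
    using assms(1) by (subst sum.remove[of _ i]) auto
  moreover have "\<forall>j<r. (if j = i then 1 else 0 :: 'k mpoly) \<in> coord_ring d"
    using coord_ring_const[of "0 :: 'k" d] coord_ring_const[of "1 :: 'k" d] by simp
  ultimately show ?thesis
    unfolding ideal_generated_def by (intro CollectI exI[of _ "\<lambda>j. if j = i then 1 else 0"] conjI)
qed

text \<open>Thanks to \<open>hom\<close>, one representative per point suffices. That condition
  speaks of values rather than monomials, so products of linear forms and the curve quadrics can be
  treated without computing their supports.\<close>

lemma vanishing_ideal_memI:
  assumes p: "p \<in> coord_ring d"
    and hom: "\<And>v t. v \<in> carrier_vec (Suc d) \<Longrightarrow> mpoly_eval (t \<cdot>\<^sub>v v) p = t ^ n * mpoly_eval v p"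
    and zero: "\<And>P. P \<in> X \<Longrightarrow> \<exists>x\<in>proj_reps 1. P = curve_point d x \<and> mpoly_eval (veronese_vec d x) p = 0"
  shows "p \<in> vanishing_ideal d X"
proof -
  have "mpoly_eval v p = 0" if P: "P \<in> X" and v: "v \<in> P" for P v
  proof -
    obtain x where x: "x \<in> proj_reps 1" "P = curve_point d x" "mpoly_eval (veronese_vec d x) p = 0"
      using zero[OF P] by blast
    then obtain c where "v = c \<cdot>\<^sub>v veronese_vec d x"
      using v curve_point_iff by blast
    then show ?thesis using hom[of "veronese_vec d x" c] x by simp
  qed
  then show ?thesis using p by (simp add: vanishing_ideal_def vanishes_at_def)
qed

section \<open>Dual linear forms and sets of at most \<open>d + 1\<close> points\<close>

lemma binary_form_product:
  fixes a b :: "'i \<Rightarrow> 'k::field"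
  assumes "finite A"
  shows "\<exists>c. \<forall>x y. (\<Prod>q\<in>A. a q * y - b q * x) = (\<Sum>k\<le>card A. c k * (x ^ (card A - k) * y ^ k))"
  using assms
proof (induction A rule: finite_induct)
  case empty
  show ?case by (rule exI[of _ "\<lambda>_. 1"]) simp
next
  case (insert q A)
  then obtain c where c: "\<And>x y. (\<Prod>q\<in>A. a q * y - b q * x) = (\<Sum>k\<le>card A. c k * (x ^ (card A - k) * y ^ k))"
    by blast
  let ?n = "card A"
  \<comment> \<open>Multiplication by \<open>a q * y\<close> shifts the coefficients by one,
    multiplication by \<open>b q * x\<close> keeps the exponent of \<open>y\<close>. The case
    \<open>k = 0\<close> is separate because \<open>0 - 1 = 0\<close>, and \<open>c2\<close> is cut
    off above \<open>?n\<close>, where \<open>c\<close> is arbitrary.\<close>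
  define c1 where "c1 k = (if k = 0 then 0 else a q * c (k - 1))" for k
  define c2 where "c2 k = (if k \<le> ?n then b q * c k else 0)" for k
  have "(\<Prod>q\<in>insert q A. a q * y - b q * x)
      = (\<Sum>k\<le>Suc ?n. (c1 k - c2 k) * (x ^ (Suc ?n - k) * y ^ k))" for x y
  proof -
    have 1: "(\<Sum>k\<le>Suc ?n. c1 k * (x ^ (Suc ?n - k) * y ^ k))
        = a q * y * (\<Sum>k\<le>?n. c k * (x ^ (?n - k) * y ^ k))"
      by (subst sum.atMost_Suc_shift) (simp add: c1_def sum_distrib_left mult.assoc mult.left_commute)
    have "(\<Sum>k\<le>Suc ?n. c2 k * (x ^ (Suc ?n - k) * y ^ k)) = (\<Sum>k\<le>?n. c2 k * (x ^ (Suc ?n - k) * y ^ k))"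
      by (simp add: c2_def)
    also have "\<dots> = b q * x * (\<Sum>k\<le>?n. c k * (x ^ (?n - k) * y ^ k))"
      unfolding sum_distrib_left
      by (rule sum.cong) (simp_all add: c2_def Suc_diff_le)
    finally have 2: "(\<Sum>k\<le>Suc ?n. c2 k * (x ^ (Suc ?n - k) * y ^ k))
        = b q * x * (\<Sum>k\<le>?n. c k * (x ^ (?n - k) * y ^ k))" .
    have "(\<Prod>q\<in>insert q A. a q * y - b q * x)
        = a q * y * (\<Sum>k\<le>?n. c k * (x ^ (?n - k) * y ^ k)) - b q * x * (\<Sum>k\<le>?n. c k * (x ^ (?n - k) * y ^ k))"
      using insert.hyps by (simp add: c left_diff_distrib)
    also have "\<dots> = (\<Sum>k\<le>Suc ?n. (c1 k - c2 k) * (x ^ (Suc ?n - k) * y ^ k))"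
      unfolding 1[symmetric] 2[symmetric] by (simp only: left_diff_distrib sum_subtractf)
    finally show ?thesis .
  qed
  then show ?case
    using insert.hyps by (intro exI[of _ "\<lambda>k. c1 k - c2 k"]) simp
qed

text \<open>The form dual to \<open>P\<close> restricts on the curve to the binary form of degree \<open>d\<close> whose roots are
  the other \<open>d\<close> points.\<close>

lemma dual_linear_forms:
  fixes Y :: "'k::field vec set set"
  assumes fin: "finite Y" and Y: "Y \<subseteq> rational_normal_curve d" and card: "card Y = Suc d"
  obtains u l where "\<And>P. P \<in> Y \<Longrightarrow> u P \<in> proj_reps 1" "\<And>P. P \<in> Y \<Longrightarrow> P = curve_point d (u P)"
    "\<And>P Q. P \<in> Y \<Longrightarrow> Q \<in> Y \<Longrightarrow>
      (\<Sum>k\<le>d. l P k * veronese_vec d (u Q) $ k) = (if P = Q then 1 else 0)"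
proof -
  have "\<forall>P\<in>Y. \<exists>x. x \<in> proj_reps 1 \<and> P = curve_point d x"
    using Y unfolding rational_normal_curve_eq by blast
  from bchoice[OF this] obtain u where u: "\<And>P. P \<in> Y \<Longrightarrow> u P \<in> proj_reps 1"
    "\<And>P. P \<in> Y \<Longrightarrow> P = curve_point d (u P)" by blast
  \<comment> \<open>Each factor is the determinant of \<open>u R\<close> and \<open>u Q\<close>. It
    vanishes for \<open>R = Q\<close>, so \<open>g P\<close> vanishes at every other point of
    \<open>Y\<close>, but not at \<open>P\<close>.\<close>
  define g where "g P Q = (\<Prod>R\<in>Y - {P}. u R $ 0 * u Q $ 1 - u R $ 1 * u Q $ 0)" for P Q
  have "\<exists>c. \<forall>Q. g P Q = (\<Sum>k\<le>d. c k * veronese_vec d (u Q) $ k)" if P: "P \<in> Y" for P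
  proof -
    have d: "card (Y - {P}) = d" using card fin P by simp
    have "finite (Y - {P})" using fin by simp
    from binary_form_product[OF this, of "\<lambda>R. u R $ 0" "\<lambda>R. u R $ 1"]
    obtain c where "\<And>x y. (\<Prod>R\<in>Y - {P}. u R $ 0 * y - u R $ 1 * x)
      = (\<Sum>k\<le>d. c k * (x ^ (d - k) * y ^ k))" unfolding d by blast
    then have "g P Q = (\<Sum>k\<le>d. c k * veronese_vec d (u Q) $ k)" for Q
      unfolding g_def by simp
    then show ?thesis by blast
  qed
  then have "\<forall>P\<in>Y. \<exists>c. \<forall>Q. g P Q = (\<Sum>k\<le>d. c k * veronese_vec d (u Q) $ k)" by blast
  from bchoice[OF this] obtain c
    where c: "\<And>P Q. P \<in> Y \<Longrightarrow> g P Q = (\<Sum>k\<le>d. c P k * veronese_vec d (u Q) $ k)" by blast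
  have g0: "g P Q = 0" if "P \<in> Y" "Q \<in> Y" "P \<noteq> Q" for P Q
    unfolding g_def by (rule prod_zero[OF finite_Diff[OF fin]]) (use that in \<open>auto intro!: bexI[of _ Q]\<close>)
  have g1: "g P P \<noteq> 0" if P: "P \<in> Y" for P
  proof -
    have "u R $ 0 * u P $ 1 \<noteq> u R $ 1 * u P $ 0" if "R \<in> Y - {P}" for R
      using curve_point_eq_of_det[of "u R" "u P" d] u P that by auto
    then show ?thesis unfolding g_def using fin by (simp add: prod_zero_iff)
  qed
  have "(\<Sum>k\<le>d. (c P k / g P P) * veronese_vec d (u Q) $ k) = (if P = Q then 1 else 0)"
    if "P \<in> Y" "Q \<in> Y" for P Q
  proof -
    have "(\<Sum>k\<le>d. (c P k / g P P) * veronese_vec d (u Q) $ k) = g P Q / g P P"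
      unfolding c[OF that(1), of Q] sum_divide_distrib by (rule sum.cong) simp_all
    then show ?thesis using g0[OF that] g1[OF that(1)] by auto
  qed
  then show thesis using that[of u "\<lambda>P k. c P k / g P P"] u by blast
qed

lemma mpoly_eval_linear_form_smult:
  assumes "v \<in> carrier_vec (Suc d)"
  shows "mpoly_eval (t \<cdot>\<^sub>v v) (linear_form d c) = t * mpoly_eval v (linear_form d c)"
  unfolding mpoly_eval_linear_form sum_distrib_left
  by (rule sum.cong) (use assms in auto)

lemma card_degree_1_2_le:
  fixes e :: "nat \<Rightarrow> nat"
  shows "card {i. i < r \<and> e i = 1} + card {i. i < r \<and> e i = 2} \<le> r"
proof -
  have "card {i. i < r \<and> e i = 1} + card {i. i < r \<and> e i = 2}
      = card ({i. i < r \<and> e i = 1} \<union> {i. i < r \<and> e i = 2})"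
    by (subst card_Un_disjoint) auto
  also have "\<dots> \<le> card {..<r}"
    by (rule card_mono) auto
  finally show ?thesis by simp
qed

text \<open>Modulo the linear generators, which vanish at \<open>P + Q\<close> for \<open>P, Q \<in> X\<close>, the products of two dual
  forms are independent: their values at the vectors \<open>P + Q\<close> form an identity matrix.\<close>

lemma generators_few_points:
  fixes F :: "nat \<Rightarrow> 'k::field_char_0 mpoly"
  assumes fin: "finite Y" and Y: "Y \<subseteq> rational_normal_curve d" and card: "card Y = Suc d"
    and XY: "X \<subseteq> Y"
    and F: "\<And>i. i < r \<Longrightarrow> F i \<in> coord_ring d \<and> homogeneous (e i) (F i)"
    and pos: "\<And>i. i < r \<Longrightarrow> e i > 0"
    and gen: "vanishing_ideal d X = ideal_generated d r F"
  shows "(Suc d - card X) + (card X choose 2) \<le> r"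
proof -
  \<comment> \<open>Completing \<open>X\<close> to \<open>d + 1\<close> points makes the vectors
    \<open>w P\<close> a basis, with the forms \<open>L P\<close> as dual basis.\<close>
  obtain u l where u: "\<And>P. P \<in> Y \<Longrightarrow> u P \<in> proj_reps 1" "\<And>P. P \<in> Y \<Longrightarrow> P = curve_point d (u P)"
    and dual: "\<And>P Q. P \<in> Y \<Longrightarrow> Q \<in> Y \<Longrightarrow>
      (\<Sum>k\<le>d. l P k * veronese_vec d (u Q) $ k) = (if P = Q then 1 else 0)"
    using dual_linear_forms[OF fin Y card] by blast
  define w where "w P = veronese_vec d (u P)" for P
  have wc: "w P \<in> carrier_vec (Suc d)" for P by (simp add: w_def)
  define L where "L P = linear_form d (l P)" for P
  have Lw: "mpoly_eval (w Q) (L P) = (if P = Q then 1 else 0)" if "P \<in> Y" "Q \<in> Y" for P Q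
    unfolding L_def mpoly_eval_linear_form w_def by (rule dual[OF that])
  have Ls: "mpoly_eval (t \<cdot>\<^sub>v v) (L P) = t * mpoly_eval v (L P)" if "v \<in> carrier_vec (Suc d)" for t v P
    unfolding L_def by (rule mpoly_eval_linear_form_smult[OF that])
  have Lc: "L P \<in> coord_ring d" for P unfolding L_def by (rule coord_ring_linear_form)
  let ?B1 = "{i. i < r \<and> e i = 1}" and ?B2 = "{i. i < r \<and> e i = 2}"
  have finX: "finite X" using fin XY finite_subset by blast

  \<comment> \<open>The forms dual to the points outside \<open>X\<close> vanish on \<open>X\<close>
    and are independent; being of degree 1, they are constant combinations of the linear
    generators.\<close>
  have c1: "card (Y - X) \<le> card ?B1"
  proof -
    have "\<exists>\<alpha>. \<forall>Q\<in>Y. mpoly_eval (w Q) (L P) = (\<Sum>i\<in>?B1. \<alpha> i * mpoly_eval (w Q) (F i))"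
      if P: "P \<in> Y - X" for P
    proof -
      have "L P \<in> vanishing_ideal d X"
      proof (rule vanishing_ideal_memI[where n = 1, OF Lc])
        fix Q assume "Q \<in> X"
        then have "Q \<in> Y" "mpoly_eval (w Q) (L P) = 0" using XY P Lw by auto
        then show "\<exists>x\<in>proj_reps 1. Q = curve_point d x \<and> mpoly_eval (veronese_vec d x) (L P) = 0"
          using u unfolding w_def by blast
      qed (simp add: Ls)
      then have "L P \<in> ideal_generated d r F" using gen by simp
      from ideal_generated_degree_part[where n = 1, OF F this]
      obtain \<alpha> where "\<forall>v\<in>carrier_vec (Suc d). (\<forall>i<r. e i < 1 \<longrightarrow> mpoly_eval v (F i) = 0) \<longrightarrow>
          mpoly_eval v (L P) = (\<Sum>i\<in>?B1. \<alpha> i * mpoly_eval v (F i))"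
        using Ls by auto
      moreover have "\<forall>i<r. e i < 1 \<longrightarrow> mpoly_eval v (F i) = 0" for v
        using pos by fastforce
      ultimately show ?thesis using wc by blast
    qed
    then have "\<forall>P\<in>Y - X. \<exists>\<alpha>. \<forall>Q\<in>Y. mpoly_eval (w Q) (L P) = (\<Sum>i\<in>?B1. \<alpha> i * mpoly_eval (w Q) (F i))"
      by blast
    from bchoice[OF this] obtain \<alpha> where \<alpha>: "\<And>P Q. P \<in> Y - X \<Longrightarrow> Q \<in> Y \<Longrightarrow>
        mpoly_eval (w Q) (L P) = (\<Sum>i\<in>?B1. \<alpha> P i * mpoly_eval (w Q) (F i))" by blast
    show ?thesis
    proof (rule left_inverse_card(1)[where c = \<alpha> and f = "\<lambda>i Q. mpoly_eval (w Q) (F i)"])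
      fix P Q assume PQ: "P \<in> Y - X" "Q \<in> Y - X"
      then show "(\<Sum>i\<in>?B1. \<alpha> P i * mpoly_eval (w Q) (F i)) = (if P = Q then 1 else 0)"
        using \<alpha>[of P Q] Lw[of P Q] by simp
    qed (use fin in auto)
  qed

  let ?I = "{S. S \<subseteq> X \<and> card S = 2}"
  define q where "q S = (\<Prod>P\<in>S. L P)" for S
  \<comment> \<open>Each \<open>q S\<close> vanishes on \<open>X\<close>, so vectors off
    \<open>X\<close> are needed to tell these products apart; the linear generators still vanish at
    sums of two vectors.\<close>
  define z where "z S = vec (Suc d) (\<lambda>k. \<Sum>P\<in>S. w P $ k)" for S
  have finS: "finite S" if "S \<in> ?I" for S using that finX finite_subset by blast
  have c2: "card ?I \<le> card ?B2"
  proof -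
    have low: "mpoly_eval (z S) (F i) = 0" if S: "S \<in> ?I" and i: "i < r" "e i < 2" for S i
    proof -
      have e1: "homogeneous 1 (F i)" using F[OF i(1)] pos[OF i(1)] i(2) by (metis One_nat_def less_2_cases less_numeral_extra(3))
      obtain c where c: "\<And>v. mpoly_eval v (F i) = (\<Sum>k\<le>d. c k * v $ k)"
        using mpoly_eval_homogeneous_1[OF _ e1] F[OF i(1)] by blast
      have "F i \<in> vanishing_ideal d X"
        unfolding gen using generator_in_ideal_generated i(1) F by blast
      then have "mpoly_eval (w P) (F i) = 0" if "P \<in> X" for P
        using that u[of P] XY veronese_vec_in_curve_point[of "u P" d]
        unfolding vanishing_ideal_def vanishes_at_def w_def by auto
      then have "(\<Sum>P\<in>S. mpoly_eval (w P) (F i)) = 0"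
        using S by (intro sum.neutral) auto
      moreover have "mpoly_eval (z S) (F i) = (\<Sum>k\<le>d. \<Sum>P\<in>S. c k * w P $ k)"
        unfolding c z_def by (rule sum.cong) (simp_all add: sum_distrib_left)
      ultimately show ?thesis
        unfolding c by (subst (asm) sum.swap) simp
    qed
    have qz: "mpoly_eval (z T) (q S) = (if S = T then 1 else 0)" if ST: "S \<in> ?I" "T \<in> ?I" for S T
    proof -
      have "mpoly_eval (z T) (L P) = (if P \<in> T then 1 else 0)" if P: "P \<in> S" for P
      proof -
        have "mpoly_eval (z T) (L P) = (\<Sum>k\<le>d. \<Sum>Q\<in>T. l P k * w Q $ k)"
          unfolding L_def mpoly_eval_linear_form z_def by (rule sum.cong) (simp_all add: sum_distrib_left)
        also have "\<dots> = (\<Sum>Q\<in>T. mpoly_eval (w Q) (L P))"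
          unfolding L_def mpoly_eval_linear_form by (rule sum.swap)
        also have "\<dots> = (\<Sum>Q\<in>T. if P = Q then 1 else 0)"
          by (rule sum.cong[OF refl], rule Lw) (use P ST XY in auto)
        also have "\<dots> = (if P \<in> T then 1 else 0)"
          using finS[OF ST(2)] by simp
        finally show ?thesis .
      qed
      then have "mpoly_eval (z T) (q S) = (\<Prod>P\<in>S. if P \<in> T then 1 else 0)"
        unfolding q_def mpoly_eval_prod[OF finS[OF ST(1)]] by (rule prod.cong[OF refl])
      also have "\<dots> = (if S \<subseteq> T then 1 else 0)"
        using finS[OF ST(1)] by (auto intro!: prod.neutral prod_zero)
      also have "S \<subseteq> T \<longleftrightarrow> S = T"
        using card_subset_eq[OF finS[OF ST(2)], of S] ST by auto
      finally show ?thesis .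
    qed
    have "\<exists>\<alpha>. \<forall>T\<in>?I. mpoly_eval (z T) (q S) = (\<Sum>i\<in>?B2. \<alpha> i * mpoly_eval (z T) (F i))"
      if S: "S \<in> ?I" for S
    proof -
      have hom: "mpoly_eval (t \<cdot>\<^sub>v v) (q S) = t ^ 2 * mpoly_eval v (q S)" if "v \<in> carrier_vec (Suc d)" for v t
      proof -
        have "mpoly_eval (t \<cdot>\<^sub>v v) (q S) = (\<Prod>P\<in>S. t * mpoly_eval v (L P))"
          unfolding q_def mpoly_eval_prod[OF finS[OF S]] Ls[OF that] ..
        also have "\<dots> = t ^ card S * mpoly_eval v (q S)"
          unfolding q_def mpoly_eval_prod[OF finS[OF S]] prod.distrib prod_constant ..
        finally show ?thesis using S by simp
      qed
      have "q S \<in> vanishing_ideal d X"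
      proof (rule vanishing_ideal_memI[where n = 2])
        show "q S \<in> coord_ring d" unfolding q_def by (rule coord_ring_prod) (rule Lc)
      next
        fix Q assume Q: "Q \<in> X"
        \<comment> \<open>A pair contains a point different from \<open>Q\<close>, whose dual form
          vanishes at \<open>w Q\<close>.\<close>
        have "\<not> S \<subseteq> {Q}"
          using S card_mono[of "{Q}" S] by auto
        then obtain P where P: "P \<in> S" "P \<noteq> Q" by blast
        then have "P \<in> Y" "Q \<in> Y" using S Q XY by blast+
        then have "mpoly_eval (w Q) (L P) = 0" using Lw[of P Q] P(2) by simp
        then have "mpoly_eval (w Q) (q S) = 0"
          unfolding q_def mpoly_eval_prod[OF finS[OF S]]
          using P(1) by (intro prod_zero[OF finS[OF S]]) blast
        then show "\<exists>x\<in>proj_reps 1. Q = curve_point d x \<and> mpoly_eval (veronese_vec d x) (q S) = 0"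
          using u Q XY unfolding w_def by blast
      qed (rule hom)
      then have "q S \<in> ideal_generated d r F" using gen by simp
      from ideal_generated_degree_part[where n = 2, OF F this hom]
      obtain \<alpha> where "\<forall>v\<in>carrier_vec (Suc d). (\<forall>i<r. e i < 2 \<longrightarrow> mpoly_eval v (F i) = 0) \<longrightarrow>
          mpoly_eval v (q S) = (\<Sum>i\<in>?B2. \<alpha> i * mpoly_eval v (F i))"
        by blast
      moreover have "z T \<in> carrier_vec (Suc d)" for T by (simp add: z_def)
      ultimately show ?thesis using low by blast
    qed
    then have "\<forall>S\<in>?I. \<exists>\<alpha>. \<forall>T\<in>?I. mpoly_eval (z T) (q S) = (\<Sum>i\<in>?B2. \<alpha> i * mpoly_eval (z T) (F i))"
      by blast
    from bchoice[OF this] obtain \<alpha> where \<alpha>: "\<And>S T. S \<in> ?I \<Longrightarrow> T \<in> ?I \<Longrightarrow>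
        mpoly_eval (z T) (q S) = (\<Sum>i\<in>?B2. \<alpha> S i * mpoly_eval (z T) (F i))" by blast
    show ?thesis
    proof (rule left_inverse_card(1)[where c = \<alpha> and f = "\<lambda>i T. mpoly_eval (z T) (F i)"])
      show "finite ?I" using finX by simp
      show "finite ?B2" by simp
      fix S T assume ST: "S \<in> ?I" "T \<in> ?I"
      show "(\<Sum>i\<in>?B2. \<alpha> S i * mpoly_eval (z T) (F i)) = (if S = T then 1 else 0)"
        using \<alpha>[OF ST] qz[OF ST] by simp
    qed
  qed
  have "card ?I = card X choose 2" by (rule n_subsets[OF finX])
  moreover have "card (Y - X) = Suc d - card X"
    using card_Diff_subset[OF finX XY] card by simp
  ultimately show ?thesis using c1 c2 card_degree_1_2_le[of r e] by linarith
qed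

section \<open>Quadrics through the curve and sets of more than \<open>d + 1\<close> points\<close>

text \<open>The monomial subtracted from \<open>x\<^sub>i x\<^sub>j\<close> involves \<open>x\<^sub>0\<close> or \<open>x\<^sub>d\<close>, while \<open>1 \<le> i \<le> j < d\<close>; so the
  matrix of coefficients at the monomials \<open>x\<^sub>i x\<^sub>j\<close> is the identity.\<close>

definition curve_quadric :: "nat \<Rightarrow> nat \<times> nat \<Rightarrow> 'k::field mpoly" where
  "curve_quadric d = (\<lambda>(j, i). mvar i * mvar j -
     (if i + j \<le> d then mvar 0 * mvar (i + j) else mvar (i + j - d) * mvar d))"

text \<open>The larger index comes first because the range of the smaller one depends on it.\<close>

definition curve_quadric_indices :: "nat \<Rightarrow> (nat \<times> nat) set" where
  "curve_quadric_indices d = (SIGMA j:{..<d}. {1..j})"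

lemma card_curve_quadric_indices: "card (curve_quadric_indices d) = d choose 2"
proof -
  have "card (curve_quadric_indices d) = (\<Sum>j<d. j)"
    unfolding curve_quadric_indices_def by (subst card_SigmaI) auto
  also have "\<dots> = d choose 2"
    by (induction d) (auto simp: numeral_2_eq_2)
  finally show ?thesis .
qed

lemma curve_quadric_coord_ring:
  assumes "q \<in> curve_quadric_indices d"
  shows "curve_quadric d q \<in> coord_ring d"
  using assms unfolding curve_quadric_def curve_quadric_indices_def
  by (auto intro!: coord_ring_diff coord_ring_mult coord_ring_mvar)

lemma curve_quadric_smult:
  assumes "q \<in> curve_quadric_indices d" "v \<in> carrier_vec (Suc d)"
  shows "mpoly_eval (t \<cdot>\<^sub>v v) (curve_quadric d q) = t ^ 2 * mpoly_eval v (curve_quadric d q)"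
proof -
  obtain j i where q: "q = (j, i)" by fastforce
  then have "i \<le> j" "j < d" using assms(1) by (auto simp: curve_quadric_indices_def)
  then show ?thesis
    using assms(2) unfolding q by (simp add: curve_quadric_def power2_eq_square right_diff_distrib)
qed

text \<open>On the curve a product of two coordinates depends only on the sum of their indices, and
  both monomials of a curve quadric have the same index sum.\<close>

lemma curve_quadric_veronese:
  assumes "q \<in> curve_quadric_indices d"
  shows "mpoly_eval (veronese_vec d x) (curve_quadric d q) = 0"
proof -
  obtain j i where q: "q = (j, i)" by fastforce
  then have ij: "i \<le> j" "j < d" using assms(1) by (auto simp: curve_quadric_indices_def)
  have *: "veronese_vec d x $ a * veronese_vec d x $ b = x $ 0 ^ (2 * d - (a + b)) * x $ 1 ^ (a + b)"
    if "a \<le> d" "b \<le> d" for a b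
  proof -
    have e: "2 * d - (a + b) = (d - a) + (d - b)" using that by simp
    show ?thesis unfolding e power_add veronese_vec_index[OF that(1)] veronese_vec_index[OF that(2)]
      by (simp only: mult_ac)
  qed
  show ?thesis
  proof (cases "i + j \<le> d")
    case True
    then have "mpoly_eval v (curve_quadric d q) = v $ i * v $ j - v $ 0 * v $ (i + j)" for v :: "'a vec"
      unfolding q by (simp add: curve_quadric_def)
    then show ?thesis
      using *[of i j] *[of 0 "i + j"] ij True by (simp del: veronese_vec_index)
  next
    case False
    then have "mpoly_eval v (curve_quadric d q) = v $ i * v $ j - v $ (i + j - d) * v $ d" for v :: "'a vec"
      unfolding q by (simp add: curve_quadric_def)
    then show ?thesis
      using *[of i j] *[of "i + j - d" d] ij False by (simp del: veronese_vec_index)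
  qed
qed

text \<open>For a quadratic form \<open>f\<close> this is the coefficient of the monomial \<open>x\<^sub>i x\<^sub>j\<close>.\<close>

definition polar_coeff :: "nat \<Rightarrow> nat \<times> nat \<Rightarrow> ('k::field vec \<Rightarrow> 'k) \<Rightarrow> 'k" where
  "polar_coeff d = (\<lambda>(j, i) f. if i = j then f (unit_vec (Suc d) i)
     else f (unit_vec (Suc d) i + unit_vec (Suc d) j) - f (unit_vec (Suc d) i) - f (unit_vec (Suc d) j))"

lemma polar_coeff_curve_quadric:
  assumes "p \<in> curve_quadric_indices d" "q \<in> curve_quadric_indices d"
  shows "polar_coeff d q (\<lambda>v. mpoly_eval v (curve_quadric d p)) = (if p = q then 1 else 0 :: 'k::field)"
proof -
  obtain j i b a where q: "q = (j, i)" and p: "p = (b, a)" by fastforce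
  have ij: "1 \<le> i" "i \<le> j" "j < d" and ab: "1 \<le> a" "a \<le> b" "b < d"
    using assms by (auto simp: curve_quadric_indices_def p q)
  \<comment> \<open>The test vectors have zero coordinates at 0 and \<open>d\<close>, which kills
    the subtracted monomial.\<close>
  have tail: "v $ 0 = 0 \<Longrightarrow> v $ d = 0 \<Longrightarrow> mpoly_eval v (curve_quadric d p) = v $ a * v $ b" for v :: "'k vec"
    unfolding p by (simp add: curve_quadric_def)
  define E where "E k = (unit_vec (Suc d) k :: 'k vec)" for k
  have E: "E k $ m = (if m = k then 1 else 0)" if "k \<le> d" "m \<le> d" for k m
    using that by (simp add: E_def)
  have E2: "(E k + E l) $ m = E k $ m + E l $ m" if "m \<le> d" for k l m
    using that by (simp add: E_def)
  have v1: "mpoly_eval (E k) (curve_quadric d p) = (if a = k \<and> b = k then 1 else 0)" if "1 \<le> k" "k < d" for k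
    using that ab by (subst tail) (auto simp: E)
  have v2: "mpoly_eval (E i + E j) (curve_quadric d p)
      = (E i $ a + E j $ a) * (E i $ b + E j $ b)"
    using ij ab by (subst tail) (auto simp: E E2)
  show ?thesis
  proof (cases "i = j")
    case True
    then show ?thesis
      using v1[of i] ij unfolding q polar_coeff_def E_def[symmetric] by (auto simp: p)
  next
    case False
    then show ?thesis
      using v1[of i] v1[of j] v2 ij ab unfolding q polar_coeff_def E_def[symmetric] by (auto simp: p E)
  qed
qed

text \<open>Since \<open>polar_coeff\<close> takes a function rather than a polynomial, relations
  known only for values carry over to coefficients.\<close>

lemma polar_coeff_sum:
  "polar_coeff d q (\<lambda>v. \<Sum>k\<in>B. c k * f k v) = (\<Sum>k\<in>B. c k * polar_coeff d q (f k))"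
  by (cases q) (simp add: polar_coeff_def right_diff_distrib sum_subtractf)

text \<open>In the affine parameter the form becomes a polynomial of degree at most \<open>d\<close>
  with the same coefficients; it has too many zeros unless they all vanish.\<close>

lemma linear_form_zero_on_many_points:
  fixes p :: "'k::field_char_0 mpoly"
  assumes p: "p \<in> coord_ring d" "homogeneous 1 p"
    and Y: "Y \<subseteq> rational_normal_curve d" "\<And>P. P \<in> Y \<Longrightarrow> vanishes_at p P"
    and card: "infinite Y \<or> card Y > Suc d"
  shows "mpoly_eval v p = 0"
proof -
  obtain c where c: "\<And>v. mpoly_eval v p = (\<Sum>k\<le>d. c k * v $ k)"
    using mpoly_eval_homogeneous_1[OF p] by blast
  define A where "A = (\<Sum>k\<le>d. monom (c k) k)"
  have A: "mpoly_eval (veronese_vec d (affine_rep t)) p = poly A t" for t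
    unfolding c A_def poly_sum poly_monom by (rule sum.cong) simp_all
  have coeff: "coeff A k = c k" if "k \<le> d" for k
    using that unfolding A_def coeff_sum by simp
  have "degree A \<le> d"
    unfolding A_def by (rule degree_sum_le) (auto intro: order_trans[OF degree_monom_le])
  then have "A = 0"
    using many_zeros_on_curve[OF p A Y] card by linarith
  then have "c k = 0" if "k \<le> d" for k using coeff[OF that] by simp
  then show ?thesis unfolding c by simp
qed

text \<open>Linear generators have only zero values here, so each curve quadric is a constant
  combination of the quadratic generators. Reading off coefficients by \<open>polar_coeff\<close>
  yields a one-sided inverse of the matrix \<open>\<alpha>\<close>. If the counts agree, it is
  two-sided and expresses the generators by the curve quadrics.\<close>

lemma generators_many_points:
  fixes F :: "nat \<Rightarrow> 'k::field_char_0 mpoly"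
  assumes X: "X \<subseteq> rational_normal_curve d" and card: "infinite X \<or> card X > Suc d"
    and F: "\<And>i. i < r \<Longrightarrow> F i \<in> coord_ring d \<and> homogeneous (e i) (F i)"
    and pos: "\<And>i. i < r \<Longrightarrow> e i > 0"
    and gen: "vanishing_ideal d X = ideal_generated d r F"
  shows "d choose 2 \<le> r"
    and "r = d choose 2 \<Longrightarrow> i < r \<Longrightarrow> mpoly_eval (veronese_vec d x) (F i) = 0"
proof -
  let ?I = "curve_quadric_indices d" and ?B = "{i. i < r \<and> e i = 2}"
  have fin: "finite ?I" by (simp add: curve_quadric_indices_def)
  have low: "mpoly_eval v (F i) = 0" if i: "i < r" "e i < 2" for i v
  proof (rule linear_form_zero_on_many_points[OF _ _ X _ card])
    show "F i \<in> coord_ring d" using F[OF i(1)] by simp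
    show "homogeneous 1 (F i)" using F[OF i(1)] pos[OF i(1)] i(2)
      by (metis One_nat_def less_2_cases less_numeral_extra(3))
    have "F i \<in> vanishing_ideal d X"
      unfolding gen using generator_in_ideal_generated i(1) F by blast
    then show "vanishes_at (F i) P" if "P \<in> X" for P
      using that by (simp add: vanishing_ideal_def)
  qed
  have "\<exists>\<alpha>. \<forall>v\<in>carrier_vec (Suc d). mpoly_eval v (curve_quadric d q) = (\<Sum>i\<in>?B. \<alpha> i * mpoly_eval v (F i))"
    if q: "q \<in> ?I" for q
  proof -
    have "curve_quadric d q \<in> vanishing_ideal d X"
    proof (rule vanishing_ideal_memI[where n = 2])
      show "curve_quadric d q \<in> coord_ring d" by (rule curve_quadric_coord_ring[OF q])
      fix P assume "P \<in> X"
      then show "\<exists>x\<in>proj_reps 1. P = curve_point d x \<and> mpoly_eval (veronese_vec d x) (curve_quadric d q) = 0"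
        using X curve_quadric_veronese[OF q] unfolding rational_normal_curve_eq by blast
    qed (rule curve_quadric_smult[OF q])
    then have "curve_quadric d q \<in> ideal_generated d r F" using gen by simp
    from ideal_generated_degree_part[where n = 2, OF F this curve_quadric_smult[OF q]]
    show ?thesis using low by blast
  qed
  then have "\<forall>q\<in>?I. \<exists>\<alpha>. \<forall>v\<in>carrier_vec (Suc d).
      mpoly_eval v (curve_quadric d q) = (\<Sum>i\<in>?B. \<alpha> i * mpoly_eval v (F i))" by blast
  from bchoice[OF this] obtain \<alpha> where \<alpha>: "\<And>q v. q \<in> ?I \<Longrightarrow> v \<in> carrier_vec (Suc d) \<Longrightarrow>
      mpoly_eval v (curve_quadric d q) = (\<Sum>i\<in>?B. \<alpha> q i * mpoly_eval v (F i))" by blast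
  have inv: "(\<Sum>i\<in>?B. \<alpha> p i * polar_coeff d q (\<lambda>v. mpoly_eval v (F i))) = (if p = q then 1 else 0)"
    if pq: "p \<in> ?I" "q \<in> ?I" for p q
  proof -
    have "(\<Sum>i\<in>?B. \<alpha> p i * polar_coeff d q (\<lambda>v. mpoly_eval v (F i)))
        = polar_coeff d q (\<lambda>v. \<Sum>i\<in>?B. \<alpha> p i * mpoly_eval v (F i))"
      by (rule polar_coeff_sum[symmetric])
    also have "\<dots> = polar_coeff d q (\<lambda>v. mpoly_eval v (curve_quadric d p))"
      using \<alpha>[OF pq(1)] by (cases q) (simp add: polar_coeff_def)
    finally show ?thesis unfolding polar_coeff_curve_quadric[OF pq] .
  qed
  have le: "card ?I \<le> card ?B"
    by (rule left_inverse_card(1)[OF fin _ inv]) simp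
  have Br: "card ?B \<le> r"
    using card_mono[of "{..<r}" ?B] by auto
  show "d choose 2 \<le> r"
    using le Br by (simp add: card_curve_quadric_indices)
  assume r: "r = d choose 2" and i: "i < r"
  have eq: "card ?I = card ?B"
    using le Br r by (simp add: card_curve_quadric_indices)
  \<comment> \<open>In the case of equality all \<open>r\<close> generators are quadratic.\<close>
  have "?B = {..<r}"
    using eq r by (intro card_subset_eq) (auto simp: card_curve_quadric_indices)
  then have iB: "i \<in> ?B" using i by simp
  let ?v = "veronese_vec d x"
  let ?f = "\<lambda>i q. polar_coeff d q (\<lambda>v. mpoly_eval v (F i))"
  \<comment> \<open>Insert the identity matrix, replace it by the matrix product in reverse order,
    and regroup: the inner sums become curve quadrics, which vanish on the curve.\<close>
  have "mpoly_eval ?v (F i) = (\<Sum>k\<in>?B. (if i = k then 1 else 0) * mpoly_eval ?v (F k))"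
    using iB by (simp add: if_distrib[of "\<lambda>c. c * _"] cong: if_cong)
  also have "\<dots> = (\<Sum>k\<in>?B. (\<Sum>q\<in>?I. ?f i q * \<alpha> q k) * mpoly_eval ?v (F k))"
  proof (rule sum.cong[OF refl])
    fix k assume k: "k \<in> ?B"
    have "(\<Sum>q\<in>?I. ?f i q * \<alpha> q k) = (if i = k then 1 else 0)"
      by (rule left_inverse_card(2)[OF fin _ inv eq iB k]) simp
    then show "(if i = k then 1 else 0) * mpoly_eval ?v (F k)
        = (\<Sum>q\<in>?I. ?f i q * \<alpha> q k) * mpoly_eval ?v (F k)" by (simp only:)
  qed
  also have "\<dots> = (\<Sum>k\<in>?B. \<Sum>q\<in>?I. ?f i q * (\<alpha> q k * mpoly_eval ?v (F k)))"
    by (simp only: sum_distrib_right mult.assoc)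
  also have "\<dots> = (\<Sum>q\<in>?I. \<Sum>k\<in>?B. ?f i q * (\<alpha> q k * mpoly_eval ?v (F k)))"
    by (rule sum.swap)
  also have "\<dots> = (\<Sum>q\<in>?I. ?f i q * mpoly_eval ?v (curve_quadric d q))"
    by (rule sum.cong[OF refl]) (simp only: \<alpha>[OF _ veronese_vec_carrier] sum_distrib_left)
  also have "\<dots> = 0"
    by (rule sum.neutral) (simp add: curve_quadric_veronese)
  finally show "mpoly_eval ?v (F i) = 0" .
qed

section \<open>Numerical conclusion\<close>

lemma le_choose_two:
  assumes "n \<ge> 3"
  shows "n \<le> n choose 2"
proof -
  have "n = n * 2 div 2" by simp
  also have "\<dots> \<le> n * (n - 1) div 2"
    using assms by (intro div_le_mono mult_le_mono2) simp
  finally show ?thesis by (simp only: choose_two)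
qed

theorem theorem4p3:
  fixes d :: nat
    and X :: "'k::{alg_closed_field, field_char_0} vec set set"
  assumes "d \<ge> 3"
    and "X \<subseteq> rational_normal_curve d"
    and "complete_intersection d X"
  shows "(\<exists>P. X = {P}) \<or> (\<exists>P Q. P \<noteq> Q \<and> X = {P, Q})"
proof -
  obtain r F where codim: "enat r = variety_codim d X"
    and F: "\<And>i. i < r \<Longrightarrow> F i \<in> coord_ring d" "\<And>i. i < r \<Longrightarrow> \<exists>e>0. homogeneous e (F i)"
    and gen: "vanishing_ideal d X = ideal_generated d r F"
    using assms(3) unfolding complete_intersection_def by blast
  have closed: "zariski_closed d X" and nonempty: "X \<noteq> {}"
    using assms(3) by (auto simp: complete_intersection_def projective_variety_def)
  have "\<forall>i\<in>{..<r}. \<exists>e. e > 0 \<and> homogeneous e (F i)" using F(2) by blast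
  from bchoice[OF this] obtain e
    where e: "\<And>i. i < r \<Longrightarrow> e i > 0" "\<And>i. i < r \<Longrightarrow> homogeneous (e i) (F i)" by blast
  have Fe: "F i \<in> coord_ring d \<and> homogeneous (e i) (F i)" if "i < r" for i
    using F(1) e(2) that by blast
  have "variety_codim d X \<le> enat d"
    unfolding variety_codim_def by (cases "variety_dim d X") simp_all
  then have rd: "r \<le> d" using codim by (metis enat_ord_simps(1))
  have inf: "infinite (rational_normal_curve d :: 'k vec set set)"
    using assms(1) by (intro infinite_rational_normal_curve) simp
  have "finite X \<and> card X \<le> Suc d"
  proof (rule ccontr)
    assume "\<not> ?thesis"
    then have many: "infinite X \<or> card X > Suc d" by auto
    have "d choose 2 \<le> r"
      by (rule generators_many_points(1)[OF assms(2) many Fe e(1) gen])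
    \<comment> \<open>Squeezing \<open>r\<close> between \<open>d choose 2\<close> and
      \<open>d\<close> leaves only \<open>d = 3\<close>, the twisted cubic with its three
      quadrics.\<close>
    then have r: "r = d choose 2" "r = d"
      using rd le_choose_two[OF assms(1)] by linarith+
    have Fx: "mpoly_eval (veronese_vec d x) (F i) = 0" if "i < r" for i x
      by (rule generators_many_points(2)[OF assms(2) many Fe e(1) gen r(1) that])
    have Fv: "vanishes_at (F i) P" if i: "i < r" and P: "P \<in> rational_normal_curve d" for i P
    proof -
      obtain x where x: "x \<in> proj_reps 1" "P = curve_point d x"
        using P unfolding rational_normal_curve_eq by blast
      then show ?thesis
        using vanishes_at_curve_point[OF x(1) F(1)[OF i] e(2)[OF i]] Fx[OF i] by simp
    qed
    \<comment> \<open>Every defining equation of \<open>X\<close> lies in its ideal, so it is a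
      combination of the generators and vanishes on the curve; hence \<open>X\<close> contains the
      curve.\<close>
    obtain T where T: "T \<subseteq> coord_ring d" "X = zero_locus d T"
      using closed unfolding zariski_closed_def by blast
    have "vanishes_at p P" if p: "p \<in> T" and P: "P \<in> rational_normal_curve d" for p P
    proof -
      have "p \<in> vanishing_ideal d X"
        using p T unfolding vanishing_ideal_def zero_locus_def by blast
      then obtain a where a: "p = (\<Sum>i<r. a i * F i)"
        unfolding gen ideal_generated_def by blast
      show ?thesis
        unfolding vanishes_at_def a mpoly_eval_sum mpoly_eval_mult
        using Fv P by (auto simp: vanishes_at_def intro!: sum.neutral)
    qed
    then have "rational_normal_curve d \<subseteq> X"
      using subsetD[OF rational_normal_curve_subset_proj_space] unfolding T(2) zero_locus_def by blast
    then have X: "X = rational_normal_curve d" using assms(2) by blast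
    have "enat r \<le> enat (d - 1)"
      unfolding codim X using assms(1) closed X by (intro variety_codim_rational_normal_curve) simp_all
    then show False using r(2) assms(1) by simp
  qed
  then have fin: "finite X" and card: "card X \<le> Suc d" by blast+
  \<comment> \<open>The curve is infinite, so \<open>X\<close> can be filled up to exactly
    \<open>d + 1\<close> points, as \<open>generators_few_points\<close> requires.\<close>
  have "infinite (rational_normal_curve d - X)" using inf fin by simp
  from infinite_arbitrarily_large[OF this, of "Suc d - card X"]
  obtain Z where Z: "finite Z" "card Z = Suc d - card X" "Z \<subseteq> rational_normal_curve d - X" by blast
  have "card (X \<union> Z) = Suc d"
    using Z card fin by (subst card_Un_disjoint) auto
  then have count: "(Suc d - card X) + (card X choose 2) \<le> r"
    using Z assms(2) fin
    by (intro generators_few_points[of "X \<union> Z" d X r F e, OF _ _ _ _ Fe e(1) gen]) auto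
  \<comment> \<open>For \<open>n = card X \<le> d + 1\<close> the count and \<open>r \<le> d\<close>
    give \<open>n choose 2 \<le> n - 1\<close>, whereas \<open>n \<ge> 3\<close> would give
    \<open>n \<le> n choose 2\<close>.\<close>
  have "card X < 3"
  proof (rule ccontr)
    assume "\<not> ?thesis"
    then have "card X \<le> card X choose 2" by (intro le_choose_two) simp
    then show False using count rd card by linarith
  qed
  moreover have "card X \<noteq> 0" using fin nonempty by simp
  ultimately have "card X = 1 \<or> card X = 2" by linarith
  then show ?thesis
    by (auto simp: card_1_singleton_iff card_2_iff)
qed

end
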